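(* For integers $a_1,a_2,a_3\geq 2$ let $S_{a_1,a_2,a_3}$ be the graph obtained by joining the path graphs $P_{a_1},P_{a_2},P_{a_3}$ to form two cycles (with $P_{a_2}$ as the common middle path). Let $F(x,y,z)=\sum_{a_1,a_2,a_3\geq2}\mathcal{L}(S_{a_1,a_2,a_3})x^{a_1}y^{a_2}z^{a_3}$, as a formal power series. Then $$F(x,y,z)=\frac{16x^2y^2z^2f(x,y,z)}{(1-2x)^3(1-2y)^3(1-2z)^3(1-2x-2y)(1-2x-2z)(1-2y-2z)(1-x-y-z)},$$ where $$\begin{aligned} f(x,y,z)={}&13+360y^4-96y+292y^2-456y^3-112y^5\\ &+8(56y^3-100y^2+64y-15)(x^5+z^5)\\ &-4(480y^5-2056y^4+3336y^3-2690y^2+1103y-185)xz\\ &+4xz(672y^5-3544y^4+6756y^3-6238y^2+2885y-541)(x+z)\\ &-8xz(160y^5-1304y^4+3204y^3-3520y^2+1864y-393)(x^2+z^2)\\ &-8(384y^5-2592y^4+5960y^3-6436y^2+3418y-727)x^2z^2\\ &-8xz(320y^4-1320y^3+1868y^2-1168y+281)(x^3+z^3)\\ &+16x^2z^2(64y^5-752y^4+2360y^3-3140y^2+1955y-475)(x+z)\\ &-16xz(80y^3-176y^2+138y-39)(x^4+z^4)\\ &+64x^2z^2(32y^4-190y^3+345y^2-262y+74)(x^2+z^2)\\ &+32(128y^4-696y^3+1244y^2-944y+267)x^3z^3\\ &+64x^2z^2(16y^3-50y^2+50y-17)(x^3+z^3)\\ &+128x^3z^3(32y^3-99y^2+98y-33)(x+z)\\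 &+128x^3z^3(8y^2-12y+5)(x+z)^2\\ &+(496y^5-1824y^4+2596y^3-1852y^2+675y-101)(x+z)\\ &-4(200y^5-892y^4+1470y^3-1183y^2+479y-79)(x^2+z^2)\\ &+4(112y^5-760y^4+1584y^3-1490y^2+679y-124)(x^3+z^3)\\ &+4(224y^4-760y^3+900y^2-474y+97)(x^4+z^4). \end{aligned}$$
   Context: Let $G$ be a finite connected undirected graph with vertex set $V$. A random walk labeling of $G$ is a labeling of $V$ obtainable by the following process: (1) set $i=1$, choose $v\in V$, and label $v$ with $i$; (2) as long as there are unlabeled vertices, pick $w\in V$ adjacent to $v$ and replace $v$ with $w$; if (the new) $v$ is not labeled, increase $i$ by $1$ and label $v$ with $i$. (Thus vertices are labeled $1,\ldots,|V|$ in the order of their first visit by a walk on $G$.) The number of distinct random walk labelings of $G$ is denoted $\mathcal{L}(G)$. For integers $a_1,a_2,a_3\geq 2$, the graph $S_{a_1,a_2,a_3}$ has $a_1+a_2+a_3$ vertices $u_1,\ldots,u_{a_1}$, $v_1,\ldots,v_{a_2}$, $w_1,\ldots,w_{a_3}$. Its edges are the path edges $u_iu_{i+1}$ ($1\le i<a_1$), $v_iv_{i+1}$ ($1\le i<a_2$), $w_iw_{i+1}$ ($1\le i<a_3$), together with the four edges $v_1u_1$, $v_1w_1$, $v_{a_2}u_{a_1}$, $v_{a_2}w_{a_3}$. *)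

theory Defs
  imports
    "Graph_Theory.Digraph_Component"
    "HOL-Computational_Algebra.Formal_Power_Series"
begin

section \<open>Random walk labelings\<close>

text \<open>
  A finite undirected graph is a \<^locale>\<open>pair_graph\<close>: its arc set is symmetric, and an edge \<open>vw\<close> is
  the pair of arcs \<open>(v, w)\<close>, \<open>(w, v)\<close>.

  \<open>walk_state G v i l\<close> says that the labeling process can reach the state where the walk is at \<open>v\<close>,
  the counter is \<open>i\<close>, and \<open>l\<close> is the partial labeling built so far.
\<close>

inductive walk_state :: "'a pair_pre_digraph \<Rightarrow> 'a \<Rightarrow> nat \<Rightarrow> ('a \<rightharpoonup> nat) \<Rightarrow> bool"
  for G :: "'a pair_pre_digraph" where
  start: "v \<in> pverts G \<Longrightarrow> walk_state G v 1 [v \<mapsto> 1]"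
| revisit: "walk_state G v i l \<Longrightarrow> dom l \<noteq> pverts G \<Longrightarrow> (v, w) \<in> parcs G \<Longrightarrow> w \<in> dom l
    \<Longrightarrow> walk_state G w i l"
| visit: "walk_state G v i l \<Longrightarrow> dom l \<noteq> pverts G \<Longrightarrow> (v, w) \<in> parcs G \<Longrightarrow> w \<notin> dom l
    \<Longrightarrow> walk_state G w (i + 1) (l(w \<mapsto> i + 1))"

definition random_walk_labelings :: "'a pair_pre_digraph \<Rightarrow> ('a \<rightharpoonup> nat) set" where
  "random_walk_labelings G = {l. dom l = pverts G \<and> (\<exists>v i. walk_state G v i l)}"

definition num_labelings :: "'a pair_pre_digraph \<Rightarrow> nat" where
  "num_labelings G = card (random_walk_labelings G)"

lemma (in pair_graph) walk_state_bounds: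
  assumes "walk_state G v i l"
  shows "dom l \<subseteq> pverts G" and "v \<in> dom l" and "ran l = {1..i}" and "i = card (dom l)"
proof -
  have "dom l \<subseteq> pverts G \<and> v \<in> dom l \<and> ran l = {1..i} \<and> i = card (dom l)"
    using assms
  proof (induction rule: walk_state.induct)
    case (visit v i l w)
    then have "finite (dom l)"
      using pair_finite_verts finite_subset by blast
    moreover from visit have "l w = None" "w \<in> pverts G"
      by (auto dest: in_arcsD2)
    ultimately show ?case
      using visit by (simp add: atLeastAtMostSuc_conv del: fun_upd_apply)
  next
    case (start v)
    then show ?case
      by (simp del: fun_upd_apply)
  qed auto
  then show "dom l \<subseteq> pverts G" "v \<in> dom l" "ran l = {1..i}" "i = card (dom l)"
    by auto
qed

lemma (in pair_graph) finite_random_walk_labelings: "finite (random_walk_labelings G)"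
proof (rule finite_subset)
  show "random_walk_labelings G
      \<subseteq> {l. dom l = pverts G \<and> ran l \<subseteq> {1..card (pverts G)}}"
    using walk_state_bounds by (fastforce simp: random_walk_labelings_def)
  show "finite {l :: 'a \<rightharpoonup> nat. dom l = pverts G \<and> ran l \<subseteq> {1..card (pverts G)}}"
    by (rule finite_set_of_finite_maps) (auto simp: pair_finite_verts)
qed


section \<open>The graph formed by three paths joined into two cycles\<close>

datatype S_vertex = U nat | V nat | W nat

definition S_edges :: "nat \<Rightarrow> nat \<Rightarrow> nat \<Rightarrow> S_vertex rel" where
  "S_edges a\<^sub>1 a\<^sub>2 a\<^sub>3 =
     {(U i, U (i + 1)) | i. 1 \<le> i \<and> i < a\<^sub>1} \<union>
     {(V i, V (i + 1)) | i. 1 \<le> i \<and> i < a\<^sub>2} \<union>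
     {(W i, W (i + 1)) | i. 1 \<le> i \<and> i < a\<^sub>3} \<union>
     {(V 1, U 1), (V 1, W 1), (V a\<^sub>2, U a\<^sub>1), (V a\<^sub>2, W a\<^sub>3)}"

definition S_graph :: "nat \<Rightarrow> nat \<Rightarrow> nat \<Rightarrow> S_vertex pair_pre_digraph" where
  "S_graph a\<^sub>1 a\<^sub>2 a\<^sub>3 =
     \<lparr>pverts = U ` {1..a\<^sub>1} \<union> V ` {1..a\<^sub>2} \<union> W ` {1..a\<^sub>3},
      parcs = S_edges a\<^sub>1 a\<^sub>2 a\<^sub>3 \<union> (S_edges a\<^sub>1 a\<^sub>2 a\<^sub>3)\<inverse>\<rparr>"

lemma pair_graph_S_graph:
  assumes "a\<^sub>1 \<ge> 2" "a\<^sub>2 \<ge> 2" "a\<^sub>3 \<ge> 2"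
  shows "pair_graph (S_graph a\<^sub>1 a\<^sub>2 a\<^sub>3)"
proof -
  let ?P = "pverts (S_graph a\<^sub>1 a\<^sub>2 a\<^sub>3)" and ?A = "parcs (S_graph a\<^sub>1 a\<^sub>2 a\<^sub>3)"
  have A: "?A \<subseteq> ?P \<times> ?P"
    using assms by (auto simp: S_graph_def S_edges_def)
  have P: "finite ?P"
    by (simp add: S_graph_def)
  from A P have fin: "finite ?A"
    by (meson finite_SigmaI finite_subset)
  have sym: "sym ?A"
    by (auto simp: S_graph_def sym_def)
  have loop: "fst e \<noteq> snd e" if "e \<in> ?A" for e
    using that by (auto simp: S_graph_def S_edges_def)
  show ?thesis
    by unfold_locales (use A P fin sym loop in \<open>auto simp: symmetric_def\<close>)
qed

lemma connected_S_graph: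
  assumes "a\<^sub>1 \<ge> 2" "a\<^sub>2 \<ge> 2" "a\<^sub>3 \<ge> 2"
  shows "connected (with_proj (S_graph a\<^sub>1 a\<^sub>2 a\<^sub>3))"
proof -
  let ?G = "S_graph a\<^sub>1 a\<^sub>2 a\<^sub>3"
  interpret pair_graph ?G
    by (rule pair_graph_S_graph[OF assms])
  have arc: "reachable (with_proj ?G) u v" if "(u, v) \<in> S_edges a\<^sub>1 a\<^sub>2 a\<^sub>3" for u v
    by (rule reachable_adjI) (use that in \<open>simp add: S_graph_def\<close>)
  have V: "reachable (with_proj ?G) (V 1) (V i)" if "1 \<le> i" "i \<le> a\<^sub>2" for i
    using that
  proof (induction i rule: dec_induct)
    case base
    then show ?case using assms by (intro reachable_refl) (auto simp: S_graph_def)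
  next
    case (step n)
    then show ?case
      using reachable_trans[OF _ arc[of "V n" "V (Suc n)"]] by (auto simp: S_edges_def)
  qed
  have U: "reachable (with_proj ?G) (V 1) (U i)" if "1 \<le> i" "i \<le> a\<^sub>1" for i
    using that
  proof (induction i rule: dec_induct)
    case base
    then show ?case by (intro arc) (auto simp: S_edges_def)
  next
    case (step n)
    then show ?case
      using reachable_trans[OF _ arc[of "U n" "U (Suc n)"]] by (auto simp: S_edges_def)
  qed
  have W: "reachable (with_proj ?G) (V 1) (W i)" if "1 \<le> i" "i \<le> a\<^sub>3" for i
    using that
  proof (induction i rule: dec_induct)
    case base
    then show ?case by (intro arc) (auto simp: S_edges_def)
  next
    case (step n)
    then show ?case
      using reachable_trans[OF _ arc[of "W n" "W (Suc n)"]] by (auto simp: S_edges_def)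
  qed
  have fromV: "reachable (with_proj ?G) (V 1) u" if "u \<in> pverts ?G" for u
    using that U V W by (auto simp: S_graph_def)
  have toV: "reachable (with_proj ?G) u (V 1)" if "u \<in> pverts ?G" for u
    using fromV[OF that] symmetric_reachable[OF pair_sym_arcs] by blast
  have "strongly_connected (with_proj ?G)"
    unfolding strongly_connected_def
  proof (intro conjI ballI)
    show "verts (with_proj ?G) \<noteq> {}"
      using assms by (simp add: S_graph_def)
    show "reachable (with_proj ?G) u v"
      if "u \<in> verts (with_proj ?G)" "v \<in> verts (with_proj ?G)" for u v
      using that fromV toV by (auto intro: reachable_trans)
  qed
  then show ?thesis
    unfolding connected_def strongly_connected_def
    by (auto intro: reachable_mk_symmetricI)
qed


section \<open>The generating function\<close>

unbundle fps_syntax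

text \<open>
  Power series in \<open>x\<close>, \<open>y\<close>, \<open>z\<close> are elements of \<open>\<rat>[[z]][[y]][[x]]\<close>: the coefficient of
  \<open>x\<^sup>a y\<^sup>b z\<^sup>c\<close> in \<open>F\<close> is \<open>F $ a $ b $ c\<close>, and the variables are
  \<open>fps_X\<close>, \<open>fps_const fps_X\<close> and \<open>fps_const (fps_const fps_X)\<close>.
\<close>

lemma nested_fps_monomial_nth:
  fixes x y z :: "'a::comm_ring_1 fps fps fps"
  assumes "x = fps_X" "y = fps_const fps_X" "z = fps_const (fps_const fps_X)"
  shows "(x ^ a * y ^ b * z ^ c) $ i $ j $ k = (if i = a \<and> j = b \<and> k = c then 1 else 0)"
proof -
  have "x ^ a * y ^ b * z ^ c = fps_X ^ a * fps_const (fps_X ^ b * fps_const (fps_X ^ c))"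
    using assms by (simp add: fps_const_power mult.assoc)
  then show ?thesis
    by simp
qed

text \<open>
  Division on nested series is the library's; it is the true quotient by every series with nonzero
  constant term.
\<close>

lemma nested_fps_divide_mult_cancel:
  fixes f g :: "'a::field fps fps fps"
  assumes "g $ 0 $ 0 $ 0 \<noteq> 0"
  shows "f / g * g = f"
proof -
  have 1: "inverse (g $ 0 $ 0) * g $ 0 $ 0 = 1"
    using assms by (rule inverse_mult_eq_1)
  then have 2: "inverse (g $ 0) * g $ 0 = 1"
    unfolding fps_inverse_def[of "g $ 0"]
    by (intro fps_left_inverse'[where x = "inverse (g $ 0 $ 0)"]) (simp_all add: mult.commute)
  then have 3: "inverse g * g = 1"
    unfolding fps_inverse_def[of g]
    by (intro fps_left_inverse'[where x = "inverse (g $ 0)"]) (simp_all add: mult.commute)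
  have "subdegree g = 0"
    using assms by (intro subdegree_eq_0) auto
  then have "f / g = f * inverse g"
    by (simp add: fps_divide_def)
  with 3 show ?thesis
    by (simp add: mult.assoc)
qed

definition S_gf :: "rat fps fps fps" where
  "S_gf = Abs_fps (\<lambda>a\<^sub>1. Abs_fps (\<lambda>a\<^sub>2. Abs_fps (\<lambda>a\<^sub>3.
     if a\<^sub>1 \<ge> 2 \<and> a\<^sub>2 \<ge> 2 \<and> a\<^sub>3 \<ge> 2 then of_nat (num_labelings (S_graph a\<^sub>1 a\<^sub>2 a\<^sub>3)) else 0)))"

definition S_poly :: "'a::comm_ring_1 \<Rightarrow> 'a \<Rightarrow> 'a \<Rightarrow> 'a" where
  "S_poly x y z =
     13 + 360 * y^4 - 96 * y + 292 * y^2 - 456 * y^3 - 112 * y^5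
     + 8 * (56 * y^3 - 100 * y^2 + 64 * y - 15) * (x^5 + z^5)
     - 4 * (480 * y^5 - 2056 * y^4 + 3336 * y^3 - 2690 * y^2 + 1103 * y - 185) * x * z
     + 4 * x * z * (672 * y^5 - 3544 * y^4 + 6756 * y^3 - 6238 * y^2 + 2885 * y - 541) * (x + z)
     - 8 * x * z * (160 * y^5 - 1304 * y^4 + 3204 * y^3 - 3520 * y^2 + 1864 * y - 393) * (x^2 + z^2)
     - 8 * (384 * y^5 - 2592 * y^4 + 5960 * y^3 - 6436 * y^2 + 3418 * y - 727) * x^2 * z^2
     - 8 * x * z * (320 * y^4 - 1320 * y^3 + 1868 * y^2 - 1168 * y + 281) * (x^3 + z^3)
     + 16 * x^2 * z^2 * (64 * y^5 - 752 * y^4 + 2360 * y^3 - 3140 * y^2 + 1955 * y - 475) * (x + z)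
     - 16 * x * z * (80 * y^3 - 176 * y^2 + 138 * y - 39) * (x^4 + z^4)
     + 64 * x^2 * z^2 * (32 * y^4 - 190 * y^3 + 345 * y^2 - 262 * y + 74) * (x^2 + z^2)
     + 32 * (128 * y^4 - 696 * y^3 + 1244 * y^2 - 944 * y + 267) * x^3 * z^3
     + 64 * x^2 * z^2 * (16 * y^3 - 50 * y^2 + 50 * y - 17) * (x^3 + z^3)
     + 128 * x^3 * z^3 * (32 * y^3 - 99 * y^2 + 98 * y - 33) * (x + z)
     + 128 * x^3 * z^3 * (8 * y^2 - 12 * y + 5) * (x + z)^2
     + (496 * y^5 - 1824 * y^4 + 2596 * y^3 - 1852 * y^2 + 675 * y - 101) * (x + z)
     - 4 * (200 * y^5 - 892 * y^4 + 1470 * y^3 - 1183 * y^2 + 479 * y - 79) * (x^2 + z^2)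
     + 4 * (112 * y^5 - 760 * y^4 + 1584 * y^3 - 1490 * y^2 + 679 * y - 124) * (x^3 + z^3)
     + 4 * (224 * y^4 - 760 * y^3 + 900 * y^2 - 474 * y + 97) * (x^4 + z^4)"

end

(*
  A labeling is an order on the vertices in which every vertex after the first is adjacent to an
  earlier one, so labelings can be counted by adding one frontier vertex at a time.  On the graph of
  three legs between two poles the visited set passes through at most three stages: a segment inside
  one leg, then one pole with an initial piece of each leg, then both poles with one gap left in each
  leg.  The counts in the three stages satisfy linear recurrences, hence their generating functions
  are rational.  The last one also counts graphs with outer legs of length 0 or 1; those terms are
  removed by subtracting three explicit rational functions of degree below 2 in x or in z, and no
  truncation has to be computed: it suffices that the difference is a multiple of x^2 z^2.
*)

theory Submission
  imports Defs
begin

section \<open>Labelings as connected vertex orders\<close>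

text \<open>The graph of the statement has at least two inner vertices on each outer leg, while the
  recurrences start at length 0; this mismatch shapes the end of the proof. The middle path contains
  both poles, so its leg has a_2 - 2 inner vertices and every length from 0 on is wanted: nothing is
  cut off in y, and a factor y^2 performs the shift. Cutting in x and z is an inclusion-exclusion of
  two strips and their overlap. It also explains the cubes in the denominator: the series of
  \<open>theta_count\<close> needs only squares of 1 - 2x, 1 - 2y, 1 - 2z, but at x = 0 the factors
  1 - 2x - 2y and 1 - 2x - 2z turn into 1 - 2y and 1 - 2z. The counting recurrences have constant
  coefficients except that a gap of one vertex has one end instead of two; the exception only feeds
  in series with fewer variables.\<close>

text \<open>
  In \<open>frontier\<close> and \<open>completions\<close>, \<open>T\<close> is the set of unvisited vertices; \<open>completions E n T\<close> is meant
  for \<open>n = card T\<close>.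
\<close>

definition frontier :: "'a rel \<Rightarrow> 'a set \<Rightarrow> 'a set" where
  "frontier E T = {w \<in> T. \<exists>v. (v, w) \<in> E \<and> v \<notin> T}"

primrec completions :: "'a rel \<Rightarrow> nat \<Rightarrow> 'a set \<Rightarrow> nat" where
  "completions E 0 T = 1"
| "completions E (Suc n) T = (\<Sum>w\<in>frontier E T. completions E n (T - {w}))"

primrec extensions :: "'a pair_pre_digraph \<Rightarrow> nat \<Rightarrow> ('a \<rightharpoonup> nat) \<Rightarrow> ('a \<rightharpoonup> nat) set" where
  "extensions G 0 l = {l}"
| "extensions G (Suc n) l =
     (\<Union>w\<in>frontier (parcs G) (pverts G - dom l). extensions G n (l(w \<mapsto> card (dom l) + 1)))"

lemma extensions_dom:
  assumes "l' \<in> extensions G n l" "finite (dom l)" "dom l \<subseteq> pverts G"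
  shows "finite (dom l') \<and> dom l' \<subseteq> pverts G \<and> card (dom l') = card (dom l) + n"
  using assms
proof (induction n arbitrary: l)
  case (Suc n)
  then obtain w where w: "w \<in> pverts G" "w \<notin> dom l"
    and l': "l' \<in> extensions G n (l(w \<mapsto> card (dom l) + 1))"
    by (auto simp: frontier_def)
  from Suc.IH[OF l'] Suc.prems w show ?case
    by (simp del: fun_upd_apply)
qed simp

text \<open>Makes the order of the additions readable from the final labeling, so that different
  choices on the way never produce the same labeling.\<close>

lemma extensions_apply:
  assumes "l' \<in> extensions G n l" "finite (dom l)" "dom l \<subseteq> pverts G"
  shows "(x \<in> dom l \<longrightarrow> l' x = l x) \<and> (x \<notin> dom l \<longrightarrow> l' x = Some k \<longrightarrow> card (dom l) < k)"
  using assms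
proof (induction n arbitrary: l)
  case 0
  then show ?case by auto
next
  case (Suc n)
  then obtain w where w: "w \<in> pverts G" "w \<notin> dom l"
    and l': "l' \<in> extensions G n (l(w \<mapsto> card (dom l) + 1))"
    by (auto simp: frontier_def)
  show ?case
  proof (cases "x = w")
    case True
    have "l' x = Some (card (dom l) + 1)"
      using Suc.IH[OF l'] Suc.prems(2,3) w True by (simp del: fun_upd_apply) simp
    with w True show ?thesis by auto
  next
    case False
    have "dom (l(w \<mapsto> card (dom l) + 1)) = insert w (dom l)"
      by (auto simp del: fun_upd_apply)
    moreover from this have "card (dom (l(w \<mapsto> card (dom l) + 1))) = card (dom l) + 1"
      using Suc.prems(2) w by (simp del: fun_upd_apply)
    ultimately show ?thesis
      using Suc.IH[OF l'] Suc.prems(2,3) w False by (simp del: fun_upd_apply) auto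
  qed
qed

lemma finite_extensions:
  assumes "finite (pverts G)"
  shows "finite (extensions G n l)"
proof (induction n arbitrary: l)
  case (Suc n)
  have "finite (frontier (parcs G) (pverts G - dom l))"
    using assms by (auto simp: frontier_def)
  with Suc show ?case by simp
qed simp

lemma card_extensions:
  assumes "finite (pverts G)" "dom l \<subseteq> pverts G"
  shows "card (extensions G n l) = completions (parcs G) n (pverts G - dom l)"
  using assms(2)
proof (induction n arbitrary: l)
  case (Suc n)
  let ?F = "frontier (parcs G) (pverts G - dom l)"
  let ?l = "\<lambda>w. l(w \<mapsto> card (dom l) + 1)"
  have F: "?F \<subseteq> pverts G - dom l"
    by (auto simp: frontier_def)
  have fin: "finite (dom l)"
    using Suc.prems assms(1) by (rule finite_subset)
  have dom: "finite (dom (?l w))" "dom (?l w) \<subseteq> pverts G" if "w \<in> ?F" for w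
    using fin Suc.prems F that by (auto simp del: fun_upd_apply)
  have disj: "extensions G n (?l v) \<inter> extensions G n (?l w) = {}"
    if "v \<in> ?F" "w \<in> ?F" "v \<noteq> w" for v w
  proof -
    have False if l': "l' \<in> extensions G n (?l v)" "l' \<in> extensions G n (?l w)" for l'
    proof -
      have "l' w = Some (card (dom l) + 1)"
        using extensions_apply[OF l'(2) dom[OF \<open>w \<in> ?F\<close>], of w] by simp
      moreover have "w \<notin> dom (?l v)" "card (dom (?l v)) = card (dom l) + 1"
        using \<open>v \<noteq> w\<close> subsetD[OF F \<open>v \<in> ?F\<close>] subsetD[OF F \<open>w \<in> ?F\<close>] fin
        by (auto simp del: fun_upd_apply simp: card_insert_if)
      ultimately show False
        using extensions_apply[OF l'(1) dom[OF \<open>v \<in> ?F\<close>], of w "card (dom l) + 1"] by simp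
    qed
    then show ?thesis by blast
  qed
  have "card (extensions G (Suc n) l) = (\<Sum>w\<in>?F. card (extensions G n (?l w)))"
    unfolding extensions.simps
    using finite_subset[OF F] assms(1) disj
    by (intro card_UN_disjoint) (auto intro: finite_extensions)
  also have "\<dots> = (\<Sum>w\<in>?F. completions (parcs G) n (pverts G - dom l - {w}))"
  proof (rule sum.cong)
    fix w assume w: "w \<in> ?F"
    have "pverts G - dom (?l w) = pverts G - dom l - {w}"
      by auto
    with Suc.IH[OF dom(2)[OF w]] show "card (extensions G n (?l w)) =
        completions (parcs G) n (pverts G - dom l - {w})"
      by (simp only:)
  qed simp
  finally show ?case by simp
qed simp

text \<open>\<open>extensions\<close> recurses on its first addition, whereas the walk labels its
  newest vertex last; the induction over the walk needs growth at that end.\<close>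

lemma extensions_snoc:
  assumes "l \<in> extensions G n l0" "w \<in> frontier (parcs G) (pverts G - dom l)"
  shows "l(w \<mapsto> card (dom l) + 1) \<in> extensions G (Suc n) l0"
  using assms
proof (induction n arbitrary: l0)
  case (Suc n)
  from Suc.prems(1) obtain v where v: "v \<in> frontier (parcs G) (pverts G - dom l0)"
    "l \<in> extensions G n (l0(v \<mapsto> card (dom l0) + 1))"
    by auto
  from Suc.IH[OF v(2) Suc.prems(2)] v(1) show ?case
    unfolding extensions.simps(2)[of G "Suc n"] by blast
qed auto

section \<open>Labelings of the walk as results of repeated frontier extension\<close>

context pair_graph
begin

lemma walk_state_in_extensions:
  assumes "walk_state G v i l"
  shows "\<exists>s\<in>pverts G. \<exists>n. l \<in> extensions G n [s \<mapsto> 1]"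
  using assms
proof (induction rule: walk_state.induct)
  case (start v)
  then have "[v \<mapsto> 1] \<in> extensions G 0 [v \<mapsto> 1]" by simp
  with start show ?case by blast
next
  case (visit v i l w)
  have "v \<in> dom l" "i = card (dom l)"
    using walk_state_bounds[OF visit.hyps(1)] by auto
  then have "w \<in> frontier (parcs G) (pverts G - dom l)"
    using visit.hyps in_arcsD2[OF visit.hyps(3)] unfolding frontier_def by blast
  moreover obtain s n where "s \<in> pverts G" "l \<in> extensions G n [s \<mapsto> 1]"
    using visit.IH by blast
  ultimately have "l(w \<mapsto> i + 1) \<in> extensions G (Suc n) [s \<mapsto> 1]"
    unfolding \<open>i = card (dom l)\<close> by (intro extensions_snoc)
  with \<open>s \<in> pverts G\<close> show ?case by blast
qed auto

text \<open>Moves within the visited set are \<open>revisit\<close> steps, which the process allows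
  only until the last vertex is labeled; hence the second assumption.\<close>

lemma walk_state_move:
  assumes "walk_state G u i l" "dom l \<noteq> pverts G"
    "(u, v) \<in> (parcs G \<inter> dom l \<times> dom l)\<^sup>*"
  shows "walk_state G v i l"
  using assms(3,1)
  by (induction rule: rtrancl_induct) (auto intro: walk_state.revisit[OF _ assms(2)])

text \<open>
  The walk can move freely inside the visited set, because that set is connected; hence every
  extension by a frontier vertex is a step of the process.
\<close>

definition attained :: "('a \<rightharpoonup> nat) \<Rightarrow> bool" where
  "attained l \<longleftrightarrow> dom l \<subseteq> pverts G \<and>
     (\<forall>u\<in>dom l. \<forall>v\<in>dom l. (u, v) \<in> (parcs G \<inter> dom l \<times> dom l)\<^sup>*) \<and>
     (\<exists>u\<in>dom l. walk_state G u (card (dom l)) l)"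

lemma attained_step:
  assumes l: "attained l" and w: "w \<in> frontier (parcs G) (pverts G - dom l)"
  shows "attained (l(w \<mapsto> card (dom l) + 1))" (is "attained ?l")
proof -
  from w obtain v where v: "(v, w) \<in> parcs G" "v \<in> dom l" and w': "w \<in> pverts G" "w \<notin> dom l"
    by (auto simp: frontier_def dest: in_arcsD1)
  have ne: "dom l \<noteq> pverts G"
    using w' by blast
  have fin: "finite (dom l)"
    using l pair_finite_verts unfolding attained_def by (blast intro: finite_subset)
  have "walk_state G v (card (dom l)) l"
    using l v ne walk_state_move unfolding attained_def by blast
  from walk_state.visit[OF this ne v(1) w'(2)]
  have ws: "walk_state G w (card (dom ?l)) ?l"
    using w' fin by (simp del: fun_upd_apply)
  let ?E = "parcs G \<inter> dom ?l \<times> dom ?l"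
  have "(parcs G \<inter> dom l \<times> dom l)\<^sup>* \<subseteq> ?E\<^sup>*"
    by (rule rtrancl_mono) auto
  then have old: "(a, b) \<in> ?E\<^sup>*" if "a \<in> dom l" "b \<in> dom l" for a b
    using that l unfolding attained_def by blast
  have dom: "dom ?l = insert w (dom l)"
    by (simp del: fun_upd_apply)
  have vw: "(v, w) \<in> ?E" "(w, v) \<in> ?E"
    using v arcs_symmetric unfolding dom by auto
  have conn: "(a, b) \<in> ?E\<^sup>*" if "a \<in> dom ?l" "b \<in> dom ?l" for a b
  proof -
    have "(a, v) \<in> ?E\<^sup>*"
      using that(1) old[OF _ v(2)] vw(2) unfolding dom by blast
    moreover have "(v, b) \<in> ?E\<^sup>*"
      using that(2) old[OF v(2)] vw(1) unfolding dom by blast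
    ultimately show ?thesis by (rule rtrancl_trans)
  qed
  have "dom ?l \<subseteq> pverts G" "w \<in> dom ?l"
    using l w' unfolding dom attained_def by auto
  with ws conn show ?thesis
    unfolding attained_def by blast
qed

lemma attained_extensions:
  assumes "l' \<in> extensions G n l" "attained l"
  shows "attained l'"
  using assms
proof (induction n arbitrary: l)
  case (Suc n)
  then obtain w where "w \<in> frontier (parcs G) (pverts G - dom l)"
    "l' \<in> extensions G n (l(w \<mapsto> card (dom l) + 1))"
    by auto
  with Suc.IH attained_step Suc.prems(2) show ?case by blast
qed simp

lemma random_walk_labelings_eq:
  "random_walk_labelings G = (\<Union>s\<in>pverts G. extensions G (card (pverts G) - 1) [s \<mapsto> 1])"
proof (intro equalityI subsetI)
  fix l assume "l \<in> random_walk_labelings G"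
  then obtain v i where l: "dom l = pverts G" "walk_state G v i l"
    by (auto simp: random_walk_labelings_def)
  then obtain s n where s: "s \<in> pverts G" and n: "l \<in> extensions G n [s \<mapsto> 1]"
    using walk_state_in_extensions by blast
  have "card (pverts G) = Suc n"
    using extensions_dom[OF n] s l(1) by simp
  with s n show "l \<in> (\<Union>s\<in>pverts G. extensions G (card (pverts G) - 1) [s \<mapsto> 1])"
    by auto
next
  fix l assume "l \<in> (\<Union>s\<in>pverts G. extensions G (card (pverts G) - 1) [s \<mapsto> 1])"
  then obtain s where s: "s \<in> pverts G" and l: "l \<in> extensions G (card (pverts G) - 1) [s \<mapsto> 1]"
    by auto
  have "attained [s \<mapsto> 1]"
    using s walk_state.start[of s] by (auto simp: attained_def)
  then have "attained l"
    using attained_extensions l by blast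
  moreover have "card (pverts G) > 0"
    using s pair_finite_verts card_gt_0_iff by blast
  then have "dom l = pverts G"
    using extensions_dom[OF l] s pair_finite_verts by (intro card_subset_eq) auto
  moreover from \<open>attained l\<close> obtain u where "walk_state G u (card (dom l)) l"
    unfolding attained_def by blast
  ultimately show "l \<in> random_walk_labelings G"
    unfolding random_walk_labelings_def by auto
qed

lemma num_labelings_eq_sum:
  "num_labelings G =
     (\<Sum>s\<in>pverts G. completions (parcs G) (card (pverts G) - 1) (pverts G - {s}))"
proof -
  let ?n = "card (pverts G) - 1"
  \<comment> \<open>The start vertex is the only one with label 1, since every added vertex gets a
    larger label.\<close>
  have disj: "extensions G ?n [s \<mapsto> 1] \<inter> extensions G ?n [t \<mapsto> 1] = {}"
    if "s \<in> pverts G" "t \<in> pverts G" "s \<noteq> t" for s t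
  proof -
    have False if "l \<in> extensions G ?n [s \<mapsto> 1]" "l \<in> extensions G ?n [t \<mapsto> 1]" for l
      using extensions_apply[OF that(1), of t 1] extensions_apply[OF that(2), of t]
        \<open>s \<in> pverts G\<close> \<open>t \<in> pverts G\<close> \<open>s \<noteq> t\<close> by simp
    then show ?thesis by blast
  qed
  have "num_labelings G = (\<Sum>s\<in>pverts G. card (extensions G ?n [s \<mapsto> 1]))"
    unfolding num_labelings_def random_walk_labelings_eq
    using pair_finite_verts disj by (intro card_UN_disjoint) (auto intro: finite_extensions)
  also have "\<dots> = (\<Sum>s\<in>pverts G. completions (parcs G) ?n (pverts G - {s}))"
    using pair_finite_verts by (intro sum.cong) (simp_all add: card_extensions)
  finally show ?thesis .
qed

end

text \<open>Serves both the reflection of the legs and the passage to \<open>S_graph\<close>. These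
  maps use index arithmetic that is injective only on actual vertices, hence \<open>inj_on\<close>
  with a relation confined to \<open>A\<close>.\<close>

lemma completions_image:
  assumes inj: "inj_on f A" and E: "E \<subseteq> A \<times> A" "E' = map_prod f f ` E" and "T \<subseteq> A"
  shows "completions E' n (f ` T) = completions E n T"
  using assms(4)
proof (induction n arbitrary: T)
  case (Suc n)
  have mem: "f u \<in> f ` T \<longleftrightarrow> u \<in> T" if "u \<in> A" for u
    using inj that Suc.prems by (rule inj_on_image_mem_iff)
  have edge: "(a, b) \<in> E' \<longleftrightarrow> (\<exists>u v. (u, v) \<in> E \<and> a = f u \<and> b = f v)" for a b
    unfolding E(2) by auto
  have "frontier E' (f ` T) = f ` frontier E T"
  proof (intro equalityI subsetI)
    fix b assume b: "b \<in> frontier E' (f ` T)"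
    then obtain u v where uv: "(u, v) \<in> E" "b = f v" "f u \<notin> f ` T"
      unfolding frontier_def edge by blast
    then have "u \<in> A" "v \<in> A"
      using E(1) by auto
    with mem uv b have "v \<in> frontier E T"
      unfolding frontier_def by blast
    with uv show "b \<in> f ` frontier E T"
      by blast
  next
    fix b assume "b \<in> f ` frontier E T"
    then obtain u v where uv: "(u, v) \<in> E" "b = f v" "u \<notin> T" "v \<in> T"
      unfolding frontier_def by blast
    then have "f u \<notin> f ` T"
      using E(1) mem by blast
    with uv show "b \<in> frontier E' (f ` T)"
      unfolding frontier_def edge by blast
  qed
  moreover have "inj_on f (frontier E T)"
    using inj Suc.prems by (auto simp: frontier_def inj_on_def)
  moreover have "f ` T - {f w} = f ` (T - {w})" if "w \<in> frontier E T" for w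
    using that inj Suc.prems by (auto simp: frontier_def inj_on_def)
  moreover have "completions E' n (f ` (T - {w})) = completions E n (T - {w})" for w
    using Suc.prems by (intro Suc.IH) auto
  ultimately show ?case
    by (simp add: sum.reindex cong: sum.cong)
qed simp

section \<open>Three legs between two poles\<close>

text \<open>
  Leg \<open>k < 3\<close> has the inner vertices \<open>Leg k 1, \<dots>, Leg k (n k)\<close>, listed from \<open>Lo\<close> to \<open>Hi\<close>. In \<open>S_graph\<close>
  the poles are the end vertices of the middle path, whose leg therefore has \<open>a\<^sub>2 - 2\<close> inner vertices.
\<close>

datatype theta_vertex = Lo | Hi | Leg nat nat

definition theta_edges :: "(nat \<Rightarrow> nat) \<Rightarrow> theta_vertex rel" where
  "theta_edges n =
     {(Lo, Leg k 1) | k. k < 3 \<and> 1 \<le> n k} \<union>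
     {(Leg k i, Leg k (i + 1)) | k i. k < 3 \<and> 1 \<le> i \<and> i < n k} \<union>
     {(Leg k (n k), Hi) | k. k < 3 \<and> 1 \<le> n k} \<union>
     {(Lo, Hi) | k. k < 3 \<and> n k = 0}"

definition theta_arcs :: "(nat \<Rightarrow> nat) \<Rightarrow> theta_vertex rel" where
  "theta_arcs n = theta_edges n \<union> (theta_edges n)\<inverse>"

definition theta_verts :: "(nat \<Rightarrow> nat) \<Rightarrow> theta_vertex set" where
  "theta_verts n = {Lo, Hi} \<union> {Leg k i | k i. k < 3 \<and> 1 \<le> i \<and> i \<le> n k}"

lemma theta_arcs_simps [simp]:
  "(Lo, Lo) \<notin> theta_arcs n" "(Hi, Hi) \<notin> theta_arcs n"
  "(Lo, Hi) \<in> theta_arcs n \<longleftrightarrow> (\<exists>k<3. n k = 0)"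
  "(Hi, Lo) \<in> theta_arcs n \<longleftrightarrow> (\<exists>k<3. n k = 0)"
  "(Lo, Leg k i) \<in> theta_arcs n \<longleftrightarrow> k < 3 \<and> 1 \<le> n k \<and> i = 1"
  "(Leg k i, Lo) \<in> theta_arcs n \<longleftrightarrow> k < 3 \<and> 1 \<le> n k \<and> i = 1"
  "(Hi, Leg k i) \<in> theta_arcs n \<longleftrightarrow> k < 3 \<and> 1 \<le> n k \<and> i = n k"
  "(Leg k i, Hi) \<in> theta_arcs n \<longleftrightarrow> k < 3 \<and> 1 \<le> n k \<and> i = n k"
  "(Leg k i, Leg m j) \<in> theta_arcs n \<longleftrightarrow>
     m = k \<and> k < 3 \<and> (1 \<le> i \<and> i < n k \<and> j = i + 1 \<or> 1 \<le> j \<and> j < n k \<and> i = j + 1)"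
  by (auto simp: theta_arcs_def theta_edges_def)

lemma ex_theta_vertex: "(\<exists>v. P v) \<longleftrightarrow> P Lo \<or> P Hi \<or> (\<exists>k i. P (Leg k i))"
  by (metis theta_vertex.exhaust)

lemma frontierI: "w \<in> T \<Longrightarrow> (v, w) \<in> E \<Longrightarrow> v \<notin> T \<Longrightarrow> w \<in> frontier E T"
  by (auto simp: frontier_def)

section \<open>Reflection exchanging the two poles\<close>

definition flip :: "(nat \<Rightarrow> nat) \<Rightarrow> theta_vertex \<Rightarrow> theta_vertex" where
  "flip n v = (case v of Lo \<Rightarrow> Hi | Hi \<Rightarrow> Lo | Leg k i \<Rightarrow> Leg k (n k + 1 - i))"

lemma flip_simps [simp]:
  "flip n Lo = Hi" "flip n Hi = Lo" "flip n (Leg k i) = Leg k (n k + 1 - i)"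
  by (simp_all add: flip_def)

lemma flip_flip: "v \<in> theta_verts n \<Longrightarrow> flip n (flip n v) = v"
  by (auto simp: theta_verts_def)

lemma theta_arcs_subset: "theta_arcs n \<subseteq> theta_verts n \<times> theta_verts n"
  by (fastforce simp: theta_arcs_def theta_edges_def theta_verts_def)

lemma flip_arc:
  assumes "(u, v) \<in> theta_arcs n"
  shows "(flip n u, flip n v) \<in> theta_arcs n"
  using assms by (cases u; cases v) auto

lemma flip_arcs: "theta_arcs n = map_prod (flip n) (flip n) ` theta_arcs n"
proof
  show "map_prod (flip n) (flip n) ` theta_arcs n \<subseteq> theta_arcs n"
    using flip_arc by auto
  show "theta_arcs n \<subseteq> map_prod (flip n) (flip n) ` theta_arcs n"
  proof clarify
    fix u v assume uv: "(u, v) \<in> theta_arcs n"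
    then have "(u, v) = map_prod (flip n) (flip n) (flip n u, flip n v)"
      using subsetD[OF theta_arcs_subset uv] by (simp add: flip_flip)
    with flip_arc[OF uv] show "(u, v) \<in> map_prod (flip n) (flip n) ` theta_arcs n"
      by blast
  qed
qed

text \<open>Spares a mirrored copy of the one-pole stage: reaching \<open>Hi\<close> first is
  counted like reaching \<open>Lo\<close> first.\<close>

lemma completions_flip:
  assumes "T \<subseteq> theta_verts n"
  shows "completions (theta_arcs n) m (flip n ` T) = completions (theta_arcs n) m T"
  using inj_on_inverseI[of "theta_verts n" "flip n" "flip n"] flip_flip
  by (intro completions_image[OF _ theta_arcs_subset flip_arcs assms]) auto

section \<open>The stage with both poles visited\<close>

definition ends :: "nat \<Rightarrow> nat" where
  "ends a = (if a = 0 then 0 else if a = 1 then 1 else 2)"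

text \<open>
  \<open>gap_count m g\<close>: both poles are visited and leg \<open>k\<close> has a gap of \<open>g k\<close> unvisited vertices;
  \<open>m\<close> is the sum of the gaps.
\<close>

primrec gap_count :: "nat \<Rightarrow> (nat \<Rightarrow> nat) \<Rightarrow> nat" where
  "gap_count 0 g = 1"
| "gap_count (Suc m) g = (\<Sum>k<3. ends (g k) * gap_count m (g(k := g k - 1)))"

definition gaps :: "(nat \<Rightarrow> nat) \<Rightarrow> (nat \<Rightarrow> nat) \<Rightarrow> theta_vertex set" where
  "gaps l g = {Leg k i | k i. k < 3 \<and> l k \<le> i \<and> i < l k + g k}"

lemma Leg_in_gaps [simp]: "Leg k i \<in> gaps l g \<longleftrightarrow> k < 3 \<and> l k \<le> i \<and> i < l k + g k"
  and poles_notin_gaps [simp]: "Lo \<notin> gaps l g" "Hi \<notin> gaps l g"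
  by (auto simp: gaps_def)

lemma theta_set_eqI:
  assumes "Lo \<in> A \<longleftrightarrow> Lo \<in> B" "Hi \<in> A \<longleftrightarrow> Hi \<in> B" "\<And>k i. Leg k i \<in> A \<longleftrightarrow> Leg k i \<in> B"
  shows "A = B"
  using assms by (metis subsetI subset_antisym theta_vertex.exhaust)

lemma frontier_gaps:
  assumes "\<And>k. k < 3 \<Longrightarrow> 1 \<le> l k \<and> l k + g k \<le> n k + 1"
  shows "frontier (theta_arcs n) (gaps l g) =
    (\<Union>k<3. if g k = 0 then {} else {Leg k (l k), Leg k (l k + g k - 1)})"
proof (rule theta_set_eqI)
  fix k i
  show "Leg k i \<in> frontier (theta_arcs n) (gaps l g) \<longleftrightarrow>
    Leg k i \<in> (\<Union>k<3. if g k = 0 then {} else {Leg k (l k), Leg k (l k + g k - 1)})"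
    (is "?L \<longleftrightarrow> ?R")
  proof
    assume ?L
    then show ?R
      using assms[of k] by (auto simp: frontier_def ex_theta_vertex)
  next
    assume ?R
    then have k: "k < 3" "g k \<noteq> 0" "i = l k \<or> i = l k + g k - 1"
      by (auto split: if_splits)
    from k(3) show ?L
    proof
      assume "i = l k"
      with k assms[of k] show ?L
        by (intro frontierI[where v = "if l k = 1 then Lo else Leg k (l k - 1)"]) auto
    next
      assume "i = l k + g k - 1"
      with k assms[of k] show ?L
        by (intro frontierI[where v = "if l k + g k = n k + 1 then Hi else Leg k (l k + g k)"]) auto
    qed
  qed
qed (auto simp: frontier_def split: if_splits)

lemma gaps_remove:
  assumes "k < 3" "g k \<noteq> 0"
  shows "gaps l g - {Leg k (l k)} = gaps (l(k := l k + 1)) (g(k := g k - 1))"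
    and "gaps l g - {Leg k (l k + g k - 1)} = gaps l (g(k := g k - 1))"
  by (rule theta_set_eqI; use assms in auto)+

lemma sum_fun_upd_pred:
  fixes g :: "nat \<Rightarrow> nat"
  assumes "finite A" "k \<in> A" "g k \<noteq> 0" "sum g A = Suc m"
  shows "sum (g(k := g k - 1)) A = m"
proof -
  have "sum (g(k := g k - 1)) A = sum g (A - {k}) + (g k - 1)"
    using assms(1,2) by (simp add: sum.remove[of A k])
  moreover have "sum g A = g k + sum g (A - {k})"
    using assms(1,2) by (simp add: sum.remove)
  ultimately show ?thesis
    using assms(3,4) by simp
qed

text \<open>Removing either end shortens a gap by one, and only the lower end moves its start. The
  count thus forgets the positions, but the induction must let \<open>l\<close> vary.\<close>

lemma completions_gaps:
  assumes "\<And>k. k < 3 \<Longrightarrow> 1 \<le> l k \<and> l k + g k \<le> n k + 1" "sum g {..<3} = m"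
  shows "completions (theta_arcs n) m (gaps l g) = gap_count m g"
  using assms
proof (induction m arbitrary: l g)
  case (Suc m)
  let ?B = "\<lambda>k. if g k = 0 then {} else {Leg k (l k), Leg k (l k + g k - 1)}"
  have step: "completions (theta_arcs n) m (gaps l g - {w}) = gap_count m (g(k := g k - 1))"
    if k: "k < 3" "w \<in> ?B k" for k w
  proof -
    have g: "g k \<noteq> 0" and w: "w = Leg k (l k) \<or> w = Leg k (l k + g k - 1)"
      using k(2) by (auto split: if_splits)
    have m: "sum (g(k := g k - 1)) {..<3} = m"
      using g k(1) Suc.prems(2) by (intro sum_fun_upd_pred) auto
    from w show ?thesis
    proof
      assume "w = Leg k (l k)"
      moreover have "1 \<le> (l(k := l k + 1)) j \<and> (l(k := l k + 1)) j + (g(k := g k - 1)) j \<le> n j + 1"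
        if "j < 3" for j
        using Suc.prems(1)[OF that] g by auto
      ultimately show ?thesis
        using Suc.IH[OF _ m] by (simp only: gaps_remove(1)[where g = g, OF k(1) g])
    next
      assume "w = Leg k (l k + g k - 1)"
      moreover have "1 \<le> l j \<and> l j + (g(k := g k - 1)) j \<le> n j + 1" if "j < 3" for j
        using Suc.prems(1)[OF that] g by auto
      ultimately show ?thesis
        using Suc.IH[OF _ m] by (simp only: gaps_remove(2)[where g = g, OF k(1) g])
    qed
  qed
  have "completions (theta_arcs n) (Suc m) (gaps l g) =
      (\<Sum>w\<in>(\<Union>k<3. ?B k). completions (theta_arcs n) m (gaps l g - {w}))"
    using frontier_gaps[OF Suc.prems(1)] by simp
  also have "\<dots> = (\<Sum>k<3. \<Sum>w\<in>?B k. completions (theta_arcs n) m (gaps l g - {w}))"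
    by (rule sum.UNION_disjoint) auto
  also have "\<dots> = (\<Sum>k<3. \<Sum>w\<in>?B k. gap_count m (g(k := g k - 1)))"
    using step by (intro sum.cong) auto
  also have "\<dots> = (\<Sum>k<3. card (?B k) * gap_count m (g(k := g k - 1)))"
    by (simp only: sum_constant of_nat_id)
  \<comment> \<open>The two ends coincide in a gap of one vertex, hence the cases of
    \<open>ends\<close>.\<close>
  also have "\<dots> = (\<Sum>k<3. ends (g k) * gap_count m (g(k := g k - 1)))"
    by (intro sum.cong) (auto simp: ends_def card_insert_if)
  finally show ?case by simp
qed simp

section \<open>The stage with one pole visited\<close>

text \<open>
  \<open>tail_count m t\<close>: \<open>Lo\<close> is visited, \<open>Hi\<close> is not, and the last \<open>t k\<close> vertices of leg \<open>k\<close> are unvisited;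
  \<open>m\<close> is the sum of the \<open>t k\<close>. The pole \<open>Hi\<close> is on the frontier once some leg is exhausted.
\<close>

primrec tail_count :: "nat \<Rightarrow> (nat \<Rightarrow> nat) \<Rightarrow> nat" where
  "tail_count 0 t = 1"
| "tail_count (Suc m) t =
     (if \<exists>k<3. t k = 0 then gap_count (Suc m) t else 0) +
     (\<Sum>k<3. if t k = 0 then 0 else tail_count m (t(k := t k - 1)))"

definition tails :: "(nat \<Rightarrow> nat) \<Rightarrow> (nat \<Rightarrow> nat) \<Rightarrow> theta_vertex set" where
  "tails n t = insert Hi (gaps (\<lambda>k. n k + 1 - t k) t)"

lemma frontier_tails:
  assumes "\<And>k. k < 3 \<Longrightarrow> t k \<le> n k"
  shows "frontier (theta_arcs n) (tails n t) =
    (if \<exists>k<3. t k = 0 then {Hi} else {}) \<union> (\<Union>k<3. if t k = 0 then {} else {Leg k (n k + 1 - t k)})"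
proof (rule theta_set_eqI)
  show "Hi \<in> frontier (theta_arcs n) (tails n t) \<longleftrightarrow> Hi \<in> (if \<exists>k<3. t k = 0 then {Hi} else {}) \<union>
    (\<Union>k<3. if t k = 0 then {} else {Leg k (n k + 1 - t k)})" (is "?L \<longleftrightarrow> ?R")
  proof
    assume ?L
    then show ?R
      using assms by (fastforce simp: frontier_def ex_theta_vertex tails_def)
  next
    assume ?R
    then obtain k where "k < 3" "t k = 0"
      by (auto split: if_splits)
    \<comment> \<open>An exhausted leg exposes \<open>Hi\<close> through its last inner vertex, or
      through \<open>Lo\<close> if it has none.\<close>
    then show ?L
      by (intro frontierI[where v = "if n k = 0 then Lo else Leg k (n k)"])
        (auto simp: tails_def)
  qed
next
  fix k i
  show "Leg k i \<in> frontier (theta_arcs n) (tails n t) \<longleftrightarrow>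
    Leg k i \<in> (if \<exists>k<3. t k = 0 then {Hi} else {}) \<union>
      (\<Union>k<3. if t k = 0 then {} else {Leg k (n k + 1 - t k)})"
    (is "?L \<longleftrightarrow> ?R")
  proof
    assume ?L
    then show ?R
      using assms[of k] by (auto simp: frontier_def ex_theta_vertex tails_def)
  next
    assume ?R
    then have "k < 3" "t k \<noteq> 0" "i = n k + 1 - t k"
      by (auto split: if_splits)
    with assms[of k] show ?L
      by (intro frontierI[where v = "if t k = n k then Lo else Leg k (n k - t k)"])
        (auto simp: tails_def)
  qed
qed (auto simp: frontier_def tails_def split: if_splits)

lemma tails_remove:
  assumes "k < 3" "t k \<noteq> 0" "t k \<le> n k"
  shows "tails n t - {Leg k (n k + 1 - t k)} = tails n (t(k := t k - 1))"
  using assms by (intro theta_set_eqI) (auto simp: tails_def)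

lemma sum_singleton: "sum f {x} = f x"
  by simp

text \<open>The number of steps exceeds \<open>m\<close> by one because \<open>Hi\<close> is
  unvisited too. Once \<open>Hi\<close> is taken, the tails are gaps reaching to the end of their
  legs, and the two-pole count takes over.\<close>

lemma completions_tails:
  assumes "\<And>k. k < 3 \<Longrightarrow> t k \<le> n k" "sum t {..<3} = m"
  shows "completions (theta_arcs n) (Suc m) (tails n t) = tail_count m t"
  using assms
proof (induction m arbitrary: t)
  case 0
  then have "frontier (theta_arcs n) (tails n t) = {Hi}"
    by (subst frontier_tails) (auto intro: exI[of _ 0])
  then show ?case by simp
next
  case (Suc m)
  let ?B = "\<lambda>k. if t k = 0 then {} else {Leg k (n k + 1 - t k)}"
  let ?c = "\<lambda>w. completions (theta_arcs n) (Suc m) (tails n t - {w})"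
  have hi: "?c Hi = gap_count (Suc m) t"
  proof -
    have "tails n t - {Hi} = gaps (\<lambda>k. n k + 1 - t k) t"
      by (auto simp: tails_def)
    then show ?thesis
      using Suc.prems by (simp only:) (intro completions_gaps, auto simp: le_SucI Suc_diff_le)
  qed
  have step: "(\<Sum>w\<in>?B k. ?c w) = (if t k = 0 then 0 else tail_count m (t(k := t k - 1)))"
    if k: "k < 3" for k
  proof (cases "t k = 0")
    case False
    have "sum (t(k := t k - 1)) {..<3} = m"
      using False k Suc.prems(2) by (intro sum_fun_upd_pred) auto
    moreover have "(t(k := t k - 1)) j \<le> n j" if "j < 3" for j
      using Suc.prems(1)[OF that] by auto
    ultimately have "completions (theta_arcs n) (Suc m) (tails n (t(k := t k - 1))) =
        tail_count m (t(k := t k - 1))"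
      by (intro Suc.IH)
    then show ?thesis
      using False tails_remove[where t = t and n = n, OF k False Suc.prems(1)[OF k]] by (simp del: completions.simps)
  qed simp
  have "completions (theta_arcs n) (Suc (Suc m)) (tails n t) =
      (\<Sum>w\<in>(if \<exists>k<3. t k = 0 then {Hi} else {}) \<union> (\<Union>k<3. ?B k). ?c w)"
    by (simp only: completions.simps(2)[of _ "Suc m"] frontier_tails[OF Suc.prems(1)])
  also have "\<dots> = (\<Sum>w\<in>(if \<exists>k<3. t k = 0 then {Hi} else {}). ?c w) + (\<Sum>w\<in>(\<Union>k<3. ?B k). ?c w)"
    by (intro sum.union_disjoint) (auto split: if_splits)
  also have "(\<Sum>w\<in>(\<Union>k<3. ?B k). ?c w) = (\<Sum>k<3. \<Sum>w\<in>?B k. ?c w)"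
    by (rule sum.UNION_disjoint) auto
  also have "\<dots> = (\<Sum>k<3. if t k = 0 then 0 else tail_count m (t(k := t k - 1)))"
    using step by (intro sum.cong) auto
  also have "(\<Sum>w\<in>(if \<exists>k<3. t k = 0 then {Hi} else {}). ?c w) =
      (if \<exists>k<3. t k = 0 then gap_count (Suc m) t else 0)"
    using hi by (cases "\<exists>k<3. t k = 0") (simp_all only: if_True if_False sum.empty sum_singleton)
  finally show ?case
    by (simp only: tail_count.simps)
qed

section \<open>The stage inside one leg\<close>

text \<open>
  \<open>segment_count f i j\<close>: no pole is visited, and the leg of the walk has \<open>i\<close> unvisited vertices next to
  \<open>Lo\<close> and \<open>j\<close> next to \<open>Hi\<close>; \<open>f x\<close> is the count when a pole has just been reached and \<open>x\<close> vertices of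
  this leg remain. Then \<open>leg_sum f m\<close> sums over the \<open>m + 1\<close> starting points in the leg.
\<close>

fun segment_count :: "(nat \<Rightarrow> nat) \<Rightarrow> nat \<Rightarrow> nat \<Rightarrow> nat" where
  "segment_count f 0 0 = f 0 + f 0"
| "segment_count f 0 (Suc j) = f (Suc j) + segment_count f 0 j"
| "segment_count f (Suc i) 0 = segment_count f i 0 + f (Suc i)"
| "segment_count f (Suc i) (Suc j) = segment_count f i (Suc j) + segment_count f (Suc i) j"

primrec leg_sum :: "(nat \<Rightarrow> nat) \<Rightarrow> nat \<Rightarrow> nat" where
  "leg_sum f 0 = 2 * f 0"
| "leg_sum f (Suc m) = 2 * f (Suc m) + 2 * leg_sum f m"

text \<open>Along an antidiagonal the moves towards \<open>Lo\<close> lead once to each pair on the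
  previous antidiagonal and once to a pole, and so do the moves towards \<open>Hi\<close>. This
  collapses the two-parameter recursion to \<open>leg_sum\<close>.\<close>

lemma sum_segment_count: "(\<Sum>i\<le>m. segment_count f i (m - i)) = leg_sum f m"
proof (induction m)
  case (Suc m)
  let ?l = "\<lambda>i j. case i of 0 \<Rightarrow> f j | Suc i' \<Rightarrow> segment_count f i' j"
  let ?r = "\<lambda>i j. case j of 0 \<Rightarrow> f i | Suc j' \<Rightarrow> segment_count f i j'"
  have "segment_count f i j = ?l i j + ?r i j" for i j
    by (cases i; cases j) auto
  then have "(\<Sum>i\<le>Suc m. segment_count f i (Suc m - i)) =
      (\<Sum>i\<le>Suc m. ?l i (Suc m - i)) + (\<Sum>i\<le>Suc m. ?r i (Suc m - i))"
    by (simp add: sum.distrib)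
  also have "(\<Sum>i\<le>Suc m. ?l i (Suc m - i)) = f (Suc m) + leg_sum f m"
    unfolding sum.atMost_Suc_shift using Suc.IH by simp
  also have "(\<Sum>i\<le>Suc m. ?r i (Suc m - i)) = leg_sum f m + f (Suc m)"
    using Suc.IH by (simp add: Suc_diff_le)
  finally show ?case by simp
qed simp

definition outside :: "(nat \<Rightarrow> nat) \<Rightarrow> nat \<Rightarrow> nat \<Rightarrow> nat \<Rightarrow> theta_vertex set" where
  "outside n k i j = theta_verts n - Leg k ` {i<..n k - j}"

lemma outside_simps [simp]:
  "Lo \<in> outside n k i j" "Hi \<in> outside n k i j"
  "Leg m x \<in> outside n k i j \<longleftrightarrow>
     m < 3 \<and> 1 \<le> x \<and> x \<le> n m \<and> \<not> (m = k \<and> i < x \<and> x \<le> n k - j)"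
  by (auto simp: outside_def theta_verts_def)

lemma frontier_outside:
  assumes "k < 3" "i + j < n k"
  shows "frontier (theta_arcs n) (outside n k i j) =
    {if i = 0 then Lo else Leg k i, if j = 0 then Hi else Leg k (n k + 1 - j)}"
proof (rule theta_set_eqI)
  show "Lo \<in> frontier (theta_arcs n) (outside n k i j) \<longleftrightarrow>
      Lo \<in> {if i = 0 then Lo else Leg k i, if j = 0 then Hi else Leg k (n k + 1 - j)}"
    using assms by (auto simp: frontier_def ex_theta_vertex)
  show "Hi \<in> frontier (theta_arcs n) (outside n k i j) \<longleftrightarrow>
      Hi \<in> {if i = 0 then Lo else Leg k i, if j = 0 then Hi else Leg k (n k + 1 - j)}"
    using assms by (auto simp: frontier_def ex_theta_vertex)
next
  fix m x
  show "Leg m x \<in> frontier (theta_arcs n) (outside n k i j) \<longleftrightarrow>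
      Leg m x \<in> {if i = 0 then Lo else Leg k i, if j = 0 then Hi else Leg k (n k + 1 - j)}"
    (is "?L \<longleftrightarrow> ?R")
  proof
    assume ?L
    then show ?R
      using assms by (auto simp: frontier_def ex_theta_vertex)
  next
    assume ?R
    then have "m = k" "i \<noteq> 0 \<and> x = i \<or> j \<noteq> 0 \<and> x = n k + 1 - j"
      by (auto split: if_splits)
    then show ?L
      using assms by (intro frontierI[where v = "Leg k (if x = i then i + 1 else n k - j)"]) auto
  qed
qed

text \<open>A pole can be taken only when the segment reaches it. Taking \<open>Lo\<close> leaves
  the other legs untouched and \<open>j\<close> vertices of leg \<open>k\<close>, which is the
  one-pole stage; taking \<open>Hi\<close> leaves the mirror image.\<close>

lemma outside_remove:
  assumes "k < 3" "i + j < n k"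
  shows "i = 0 \<Longrightarrow> outside n k i j - {Lo} = tails n (n(k := j))"
    and "j = 0 \<Longrightarrow> outside n k i j - {Hi} = flip n ` tails n (n(k := i))"
    and "i \<noteq> 0 \<Longrightarrow> outside n k i j - {Leg k i} = outside n k (i - 1) j"
    and "j \<noteq> 0 \<Longrightarrow> outside n k i j - {Leg k (n k + 1 - j)} = outside n k i (j - 1)"
proof -
  show "outside n k i j - {Lo} = tails n (n(k := j))" if "i = 0"
    using assms that by (intro theta_set_eqI) (auto simp: tails_def)
  show "outside n k i j - {Leg k i} = outside n k (i - 1) j" if "i \<noteq> 0"
    using assms that by (intro theta_set_eqI) auto
  show "outside n k i j - {Leg k (n k + 1 - j)} = outside n k i (j - 1)" if "j \<noteq> 0"
    using assms that by (intro theta_set_eqI) auto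
  show "outside n k i j - {Hi} = flip n ` tails n (n(k := i))" if "j = 0"
  proof (rule theta_set_eqI)
    fix m x
    have "Leg m x \<in> flip n ` tails n (n(k := i)) \<longleftrightarrow>
        (\<exists>y. x = n m + 1 - y \<and> Leg m y \<in> tails n (n(k := i)))"
    proof
      assume "Leg m x \<in> flip n ` tails n (n(k := i))"
      then obtain v where "Leg m x = flip n v" "v \<in> tails n (n(k := i))"
        by blast
      then show "\<exists>y. x = n m + 1 - y \<and> Leg m y \<in> tails n (n(k := i))"
        by (cases v) auto
    qed (auto intro!: image_eqI[where x = "Leg m y" for y])
    also have "\<dots> \<longleftrightarrow> Leg m x \<in> outside n k i j - {Hi}"
    proof
      assume "Leg m x \<in> outside n k i j - {Hi}"
      then show "\<exists>y. x = n m + 1 - y \<and> Leg m y \<in> tails n (n(k := i))"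
        using assms that by (intro exI[of _ "n m + 1 - x"]) (auto simp: tails_def)
    qed (use assms that in \<open>auto simp: tails_def split: if_splits\<close>)
    finally show "Leg m x \<in> outside n k i j - {Hi} \<longleftrightarrow> Leg m x \<in> flip n ` tails n (n(k := i))"
      by simp
  next
    show "Hi \<in> outside n k i j - {Hi} \<longleftrightarrow> Hi \<in> flip n ` tails n (n(k := i))"
      by (auto simp: tails_def gaps_def)
    show "Lo \<in> outside n k i j - {Hi} \<longleftrightarrow> Lo \<in> flip n ` tails n (n(k := i))"
      by (force simp: tails_def)
  qed
qed

lemma tails_subset: "(\<And>k. k < 3 \<Longrightarrow> t k \<le> n k) \<Longrightarrow> tails n t \<subseteq> theta_verts n"
  by (fastforce simp: tails_def gaps_def theta_verts_def)

lemma segment_count_rec: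
  "segment_count f i j =
     (if i = 0 then f j else segment_count f (i - 1) j) +
     (if j = 0 then f i else segment_count f i (j - 1))"
  by (cases i; cases j) auto

text \<open>Unvisited are the \<open>r\<close> inner vertices of the other legs,
  \<open>i + j\<close> of leg \<open>k\<close>, and both poles. The strict inequality says that the
  visited segment is nonempty.\<close>

lemma completions_outside:
  assumes "k < 3" "i + j < n k"
  defines "r \<equiv> sum n ({..<3} - {k})"
  shows "completions (theta_arcs n) (r + i + j + 2) (outside n k i j) =
    segment_count (\<lambda>x. tail_count (r + x) (n(k := x))) i j"
  using assms(2)
proof (induction "i + j" arbitrary: i j rule: less_induct)
  case less
  let ?f = "\<lambda>x. tail_count (r + x) (n(k := x))"
  let ?a = "if i = 0 then Lo else Leg k i" and ?b = "if j = 0 then Hi else Leg k (n k + 1 - j)"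
  let ?c = "\<lambda>w. completions (theta_arcs n) (Suc (r + i + j)) (outside n k i j - {w})"
  have f: "completions (theta_arcs n) (Suc (r + x)) (tails n (n(k := x))) = ?f x" if "x \<le> n k" for x
  proof (rule completions_tails)
    show "sum (n(k := x)) {..<3} = r + x"
      using assms(1) by (simp add: r_def sum.remove[of _ k])
  qed (use that in auto)
  have a: "?c ?a = (if i = 0 then ?f j else segment_count ?f (i - 1) j)"
  proof (cases "i = 0")
    case True
    then show ?thesis
      using f[of j] outside_remove(1)[where n = n, OF assms(1) less.prems True] less.prems
      by (simp del: completions.simps)
  next
    case False
    then show ?thesis
      using less.hyps[of "i - 1" j] outside_remove(3)[where n = n, OF assms(1) less.prems False] less.prems
      by (simp del: completions.simps)
  qed
  have b: "?c ?b = (if j = 0 then ?f i else segment_count ?f i (j - 1))"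
  proof (cases "j = 0")
    case True
    have "tails n (n(k := i)) \<subseteq> theta_verts n"
      using less.prems by (intro tails_subset) auto
    then show ?thesis
      using f[of i] outside_remove(2)[where n = n, OF assms(1) less.prems True] less.prems True
      by (simp del: completions.simps add: completions_flip)
  next
    case False
    then show ?thesis
      using less.hyps[of i "j - 1"] outside_remove(4)[where n = n, OF assms(1) less.prems False] less.prems
      by (simp del: completions.simps)
  qed
  have "?a \<noteq> ?b"
    using less.prems by auto
  have "completions (theta_arcs n) (r + i + j + 2) (outside n k i j) =
      completions (theta_arcs n) (Suc (Suc (r + i + j))) (outside n k i j)"
    by simp
  also have "\<dots> = (\<Sum>w\<in>{?a, ?b}. ?c w)"
    unfolding completions.simps(2)[of _ "Suc _"] frontier_outside[where n = n, OF assms(1) less.prems] ..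
  also have "\<dots> = ?c ?a + ?c ?b"
    using \<open>?a \<noteq> ?b\<close> by (simp del: completions.simps)
  finally show ?case
    unfolding a b by (simp only: segment_count_rec[of ?f i j])
qed

section \<open>Summation over all starting vertices\<close>

lemma sum_theta_verts:
  fixes h :: "theta_vertex \<Rightarrow> 'a::comm_monoid_add"
  shows "sum h (theta_verts n) = h Lo + h Hi + (\<Sum>k<3. \<Sum>i=1..n k. h (Leg k i))"
proof -
  have eq: "theta_verts n = {Lo, Hi} \<union> (\<Union>k<3. Leg k ` {1..n k})"
    by (auto simp: theta_verts_def)
  have "sum h (theta_verts n) = sum h {Lo, Hi} + sum h (\<Union>k<3. Leg k ` {1..n k})"
    unfolding eq by (intro sum.union_disjoint) auto
  also have "sum h (\<Union>k<3. Leg k ` {1..n k}) = (\<Sum>k<3. sum h (Leg k ` {1..n k}))"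
    by (intro sum.UNION_disjoint) auto
  also have "\<dots> = (\<Sum>k<3. \<Sum>i=1..n k. h (Leg k i))"
    by (intro sum.cong) (auto simp: sum.reindex inj_on_def)
  finally show ?thesis by simp
qed

lemma card_theta_verts: "card (theta_verts n) = sum n {..<3} + 2"
proof -
  have "card (theta_verts n) = (\<Sum>v\<in>theta_verts n. 1)"
    by simp
  also have "\<dots> = sum n {..<3} + 2"
    unfolding sum_theta_verts by simp
  finally show ?thesis .
qed

text \<open>The poles as starting vertices give equal numbers by reflection; a start inside leg
  \<open>k\<close> leaves \<open>n k - 1\<close> vertices of that leg, split in every possible
  way.\<close>

definition theta_count :: "(nat \<Rightarrow> nat) \<Rightarrow> nat" where
  "theta_count n = 2 * tail_count (sum n {..<3}) n +
     (\<Sum>k<3. if n k = 0 then 0 else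
        leg_sum (\<lambda>x. tail_count (sum n ({..<3} - {k}) + x) (n(k := x))) (n k - 1))"

lemma sum_completions_theta:
  "(\<Sum>s\<in>theta_verts n. completions (theta_arcs n) (sum n {..<3} + 1) (theta_verts n - {s})) =
    theta_count n"
proof -
  let ?N = "sum n {..<3}"
  let ?c = "\<lambda>s. completions (theta_arcs n) (?N + 1) (theta_verts n - {s})"
  have lo: "theta_verts n - {Lo} = tails n n"
    by (intro theta_set_eqI) (auto simp: theta_verts_def tails_def)
  have "flip n ` theta_verts n = theta_verts n"
  proof -
    have "flip n v \<in> theta_verts n" if "v \<in> theta_verts n" for v
      using that by (auto simp: theta_verts_def)
    then show ?thesis
      using flip_flip[of _ n] by (auto intro!: image_eqI[where x = "flip n v" for v])
  qed
  moreover have "inj_on (flip n) (theta_verts n)"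
    using flip_flip by (rule inj_on_inverseI)
  ultimately have hi: "theta_verts n - {Hi} = flip n ` tails n n"
    unfolding lo[symmetric]
    by (subst inj_on_image_set_diff[of _ "theta_verts n"]) (auto simp: theta_verts_def)
  have "?c Lo = tail_count ?N n"
    unfolding lo using completions_tails[of n n ?N] by (simp del: completions.simps)
  moreover have "?c Hi = tail_count ?N n"
    unfolding hi using completions_tails[of n n ?N] tails_subset[of n n]
    by (simp del: completions.simps add: completions_flip)
  moreover have "(\<Sum>i=1..n k. ?c (Leg k i)) = (if n k = 0 then 0 else
      leg_sum (\<lambda>x. tail_count (sum n ({..<3} - {k}) + x) (n(k := x))) (n k - 1))"
    if k: "k < 3" for k
  proof (cases "n k")
    case (Suc m)
    let ?r = "sum n ({..<3} - {k})"
    let ?f = "\<lambda>x. tail_count (?r + x) (n(k := x))"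
    have N: "?N = n k + ?r"
      using k by (simp add: sum.remove)
    have "?c (Leg k (Suc i)) = segment_count ?f i (m - i)" if "i \<le> m" for i
    proof -
      have "theta_verts n - {Leg k (Suc i)} = outside n k i (m - i)"
        using that k Suc by (intro theta_set_eqI) (auto simp: theta_verts_def)
      moreover have "?N + 1 = ?r + i + (m - i) + 2"
        using that N Suc by simp
      ultimately show ?thesis
        using completions_outside[OF k, of i "m - i" n] that Suc by (simp del: completions.simps)
    qed
    then have "(\<Sum>i\<le>m. ?c (Leg k (Suc i))) = (\<Sum>i\<le>m. segment_count ?f i (m - i))"
      by (intro sum.cong) auto
    moreover have "(\<Sum>i=1..n k. ?c (Leg k i)) = (\<Sum>i\<le>m. ?c (Leg k (Suc i)))"
      unfolding Suc One_nat_def sum.atLeast_Suc_atMost_Suc_shift by (simp add: atLeast0AtMost)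
    ultimately show ?thesis
      using Suc by (simp add: sum_segment_count)
  qed simp
  ultimately show ?thesis
    unfolding sum_theta_verts theta_count_def by simp
qed

section \<open>Isomorphism with the graph of the statement\<close>

definition theta_legs :: "nat \<Rightarrow> nat \<Rightarrow> nat \<Rightarrow> nat \<Rightarrow> nat" where
  "theta_legs a b c k = (if k = 0 then a else if k = 1 then b else if k = 2 then c else 0)"

definition S_vertex_of :: "nat \<Rightarrow> theta_vertex \<Rightarrow> S_vertex" where
  "S_vertex_of b v = (case v of Lo \<Rightarrow> V 1 | Hi \<Rightarrow> V (b + 2)
     | Leg k i \<Rightarrow> if k = 0 then U i else if k = 1 then V (i + 1) else W i)"

definition theta_vertex_of :: "nat \<Rightarrow> S_vertex \<Rightarrow> theta_vertex" where
  "theta_vertex_of b v = (case v of U i \<Rightarrow> Leg 0 i | W i \<Rightarrow> Leg 2 i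
     | V i \<Rightarrow> if i = 1 then Lo else if i = b + 2 then Hi else Leg 1 (i - 1))"

lemma less_3_iff: "k < 3 \<longleftrightarrow> k = 0 \<or> k = 1 \<or> k = (2::nat)"
  by auto

lemma num_labelings_S_graph:
  assumes "2 \<le> a" "2 \<le> c"
  shows "num_labelings (S_graph a (b + 2) c) = theta_count (theta_legs a b c)"
proof -
  let ?G = "S_graph a (b + 2) c" and ?n = "theta_legs a b c"
  let ?f = "S_vertex_of b" and ?g = "theta_vertex_of b"
  interpret pair_graph ?G
    using assms by (intro pair_graph_S_graph) auto
  have theta [simp]: "Lo \<in> theta_verts ?n" "Hi \<in> theta_verts ?n"
    "Leg k i \<in> theta_verts ?n \<longleftrightarrow> k < 3 \<and> 1 \<le> i \<and> i \<le> ?n k" for k i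
    by (auto simp: theta_verts_def)
  have verts_iff: "U i \<in> pverts ?G \<longleftrightarrow> 1 \<le> i \<and> i \<le> a"
    "V i \<in> pverts ?G \<longleftrightarrow> 1 \<le> i \<and> i \<le> b + 2" "W i \<in> pverts ?G \<longleftrightarrow> 1 \<le> i \<and> i \<le> c" for i
    by (auto simp: S_graph_def)
  have f: "?f v \<in> pverts ?G \<and> ?g (?f v) = v" if "v \<in> theta_verts ?n" for v
  proof (cases v)
    case (Leg k i)
    with that have "k = 0 \<or> k = 1 \<or> k = 2" "1 \<le> i" "i \<le> ?n k"
      by (auto simp: less_3_iff)
    then show ?thesis
      unfolding Leg by (elim disjE)
        (simp_all add: S_vertex_of_def theta_vertex_of_def theta_legs_def verts_iff del: add_2_eq_Suc')
  qed (simp_all add: S_vertex_of_def theta_vertex_of_def verts_iff del: add_2_eq_Suc')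
  have g: "?g v \<in> theta_verts ?n \<and> ?f (?g v) = v" if "v \<in> pverts ?G" for v
  proof (cases v)
    case (V i)
    with that consider "i = 1" | "i = b + 2" "i \<noteq> 1" | "i \<noteq> 1" "i \<noteq> b + 2" "1 \<le> i" "i \<le> b + 2"
      unfolding V verts_iff by fastforce
    then show ?thesis
      unfolding V by cases (auto simp: S_vertex_of_def theta_vertex_of_def theta_legs_def)
  qed (use that in \<open>simp_all add: S_vertex_of_def theta_vertex_of_def theta_legs_def verts_iff del: add_2_eq_Suc'\<close>)
  have gf: "?g (?f v) = v" if "v \<in> theta_verts ?n" for v
    using f that by blast
  have fg: "?f (?g v) = v" if "v \<in> pverts ?G" for v
    using g that by blast
  have verts: "pverts ?G = ?f ` theta_verts ?n"
  proof (intro equalityI subsetI)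
    fix v assume "v \<in> pverts ?G"
    then show "v \<in> ?f ` theta_verts ?n"
      using g[of v] by (intro image_eqI[where x = "?g v"]) simp_all
  qed (use f in blast)
  have inj: "inj_on ?f (theta_verts ?n)"
    using gf by (rule inj_on_inverseI)
  have sym: "(u, v) \<in> theta_arcs ?n \<Longrightarrow> (v, u) \<in> theta_arcs ?n" for u v
    by (auto simp: theta_arcs_def)
  have "(?g u, ?g v) \<in> theta_arcs ?n" if "(u, v) \<in> S_edges a (b + 2) c" for u v
    using that unfolding S_edges_def
  proof (elim UnE CollectE exE conjE Pair_inject)
    fix i assume "u = V i" "v = V (i + 1)" "1 \<le> i" "i < b + 2"
    \<comment> \<open>The first and last edge of the middle path meet a pole; for
      \<open>b = 0\<close> they are one edge joining the poles.\<close>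
    then consider "u = V 1" "v = V 2" "b = 0" | "u = V 1" "v = V 2" "b \<noteq> 0"
      | j where "u = V (j + 1)" "v = V (j + 2)" "1 \<le> j" "j < b" | "u = V (b + 1)" "v = V (b + 2)" "b \<noteq> 0"
      by (cases "i = 1"; cases "i = b + 1") (fastforce dest: le_Suc_ex)+
    then show ?thesis
      by cases (auto simp: theta_vertex_of_def theta_legs_def intro!: exI[of _ 1])
  qed (use assms in \<open>auto simp: theta_vertex_of_def theta_legs_def\<close>)
  then have ga: "(?g u, ?g v) \<in> theta_arcs ?n" if "(u, v) \<in> parcs ?G" for u v
    using that sym by (auto simp: S_graph_def)
  have fa: "(?f u, ?f v) \<in> parcs ?G" if "(u, v) \<in> theta_edges ?n" for u v
    using that unfolding theta_edges_def
  proof (elim UnE CollectE exE conjE Pair_inject)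
    fix k i assume "u = Leg k i" "v = Leg k (i + 1)" "k < 3" "1 \<le> i" "i < ?n k"
    then show ?thesis
      unfolding less_3_iff
      by (elim disjE) (simp_all add: S_graph_def S_edges_def S_vertex_of_def theta_legs_def)
  next
    fix k assume "u = Lo" "v = Hi" "k < 3" "?n k = 0"
    \<comment> \<open>The outer legs are nonempty, so only the middle leg can join the poles
      directly.\<close>
    then have "b = 0"
      using assms unfolding less_3_iff by (elim disjE) (simp_all add: theta_legs_def)
    with \<open>u = Lo\<close> \<open>v = Hi\<close> show ?thesis
      by (simp add: S_graph_def S_edges_def S_vertex_of_def)
  next
    fix k assume "u = Lo" "v = Leg k 1" "k < 3" "1 \<le> ?n k"
    then show ?thesis
      unfolding less_3_iff
      by (elim disjE) (simp_all add: S_graph_def S_edges_def S_vertex_of_def theta_legs_def)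
  next
    fix k assume "u = Leg k (?n k)" "v = Hi" "k < 3" "1 \<le> ?n k"
    then show ?thesis
      unfolding less_3_iff
      by (elim disjE) (simp_all add: S_graph_def S_edges_def S_vertex_of_def theta_legs_def)
  qed
  then have fa: "(?f u, ?f v) \<in> parcs ?G" if "(u, v) \<in> theta_arcs ?n" for u v
    using that arcs_symmetric by (auto simp: theta_arcs_def)
  have arcs: "parcs ?G = map_prod ?f ?f ` theta_arcs ?n"
  proof
    show "map_prod ?f ?f ` theta_arcs ?n \<subseteq> parcs ?G"
      using fa by auto
    show "parcs ?G \<subseteq> map_prod ?f ?f ` theta_arcs ?n"
    proof clarify
      fix u v assume uv: "(u, v) \<in> parcs ?G"
      then have "(u, v) = map_prod ?f ?f (?g u, ?g v)"
        using fg in_arcsD1 in_arcsD2 by auto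
      with ga[OF uv] show "(u, v) \<in> map_prod ?f ?f ` theta_arcs ?n"
        by blast
    qed
  qed
  have "num_labelings ?G = (\<Sum>s\<in>theta_verts ?n.
      completions (parcs ?G) (card (pverts ?G) - 1) (pverts ?G - {?f s}))"
    unfolding num_labelings_eq_sum verts by (simp add: sum.reindex[OF inj])
  also have "\<dots> = (\<Sum>s\<in>theta_verts ?n.
      completions (theta_arcs ?n) (sum ?n {..<3} + 1) (theta_verts ?n - {s}))"
  proof (rule sum.cong)
    fix s assume s: "s \<in> theta_verts ?n"
    have "pverts ?G - {?f s} = ?f ` (theta_verts ?n - {s})"
      using inj s unfolding verts by (subst inj_on_image_set_diff) auto
    moreover have "card (pverts ?G) - 1 = sum ?n {..<3} + 1"
      unfolding verts by (simp add: card_image[OF inj] card_theta_verts)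
    ultimately show "completions (parcs ?G) (card (pverts ?G) - 1) (pverts ?G - {?f s}) =
        completions (theta_arcs ?n) (sum ?n {..<3} + 1) (theta_verts ?n - {s})"
      by (simp only: completions_image[OF inj theta_arcs_subset arcs Diff_subset])
  qed simp
  finally show ?thesis
    by (simp only: sum_completions_theta)
qed

section \<open>Recurrences in the three lengths\<close>

lemma theta_legs_upd [simp]:
  "(theta_legs a b c)(0 := x) = theta_legs x b c"
  "(theta_legs a b c)(Suc 0 := x) = theta_legs a x c"
  "(theta_legs a b c)(2 := x) = theta_legs a b x"
  by (auto simp: theta_legs_def)

lemma theta_legs_simps [simp]:
  "theta_legs a b c 0 = a" "theta_legs a b c (Suc 0) = b" "theta_legs a b c 2 = c"
  by (auto simp: theta_legs_def)

lemma lessThan_3: "{..<3} = {0, 1, 2 :: nat}"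
  by auto

lemma sum_lessThan_3: "sum h {..<3} = h 0 + h 1 + (h 2 :: nat)" for h :: "nat \<Rightarrow> nat"
  unfolding lessThan_3 by simp

lemma sum_theta_legs: "sum (theta_legs a b c) {..<3} = a + b + c"
  by (simp add: sum_lessThan_3)

definition gap_fun :: "nat \<Rightarrow> nat \<Rightarrow> nat \<Rightarrow> nat" where
  "gap_fun a b c = gap_count (a + b + c) (theta_legs a b c)"

definition tail_fun :: "nat \<Rightarrow> nat \<Rightarrow> nat \<Rightarrow> nat" where
  "tail_fun a b c = tail_count (a + b + c) (theta_legs a b c)"

lemma gap_fun_0: "gap_fun 0 0 0 = 1"
  by (simp add: gap_fun_def)

text \<open>Truncated subtraction does no harm: a term with the predecessor of 0 carries the factor
  \<open>ends 0 = 0\<close>.\<close>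

lemma gap_fun_rec:
  assumes "a + b + c \<noteq> 0"
  shows "gap_fun a b c = ends a * gap_fun (a - 1) b c + ends b * gap_fun a (b - 1) c +
    ends c * gap_fun a b (c - 1)"
proof -
  obtain m where m: "a + b + c = Suc m"
    using assms not0_implies_Suc by blast
  have "ends a * gap_count m (theta_legs (a - 1) b c) = ends a * gap_fun (a - 1) b c"
    using m by (cases a) (auto simp: gap_fun_def ends_def)
  moreover have "ends b * gap_count m (theta_legs a (b - 1) c) = ends b * gap_fun a (b - 1) c"
    using m by (cases b) (auto simp: gap_fun_def ends_def)
  moreover have "ends c * gap_count m (theta_legs a b (c - 1)) = ends c * gap_fun a b (c - 1)"
    using m by (cases c) (auto simp: gap_fun_def ends_def)
  moreover have "gap_fun a b c = ends a * gap_count m (theta_legs (a - 1) b c) +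
      ends b * gap_count m (theta_legs a (b - 1) c) + ends c * gap_count m (theta_legs a b (c - 1))"
    unfolding gap_fun_def m by (simp add: sum_lessThan_3)
  ultimately show ?thesis by (simp only:)
qed

text \<open>The origin is no exception: there the first summand supplies
  \<open>gap_fun 0 0 0\<close> and the others vanish.\<close>

lemma tail_fun_rec:
  "tail_fun a b c =
     (if a = 0 \<or> b = 0 \<or> c = 0 then gap_fun a b c else 0) +
     (if a = 0 then 0 else tail_fun (a - 1) b c) + (if b = 0 then 0 else tail_fun a (b - 1) c) +
     (if c = 0 then 0 else tail_fun a b (c - 1))"
proof (cases "a + b + c")
  case 0
  then show ?thesis
    by (simp add: tail_fun_def gap_fun_def)
next
  case (Suc m)
  have ex: "(\<exists>k<3. theta_legs a b c k = 0) \<longleftrightarrow> a = 0 \<or> b = 0 \<or> c = 0"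
    by (simp add: less_3_iff conj_disj_distribR ex_disj_distrib)
  have "(if a = 0 then 0 else tail_count m (theta_legs (a - 1) b c)) =
      (if a = 0 then 0 else tail_fun (a - 1) b c)"
    using Suc by (cases a) (simp_all add: tail_fun_def)
  moreover have "(if b = 0 then 0 else tail_count m (theta_legs a (b - 1) c)) =
      (if b = 0 then 0 else tail_fun a (b - 1) c)"
    using Suc by (cases b) (simp_all add: tail_fun_def)
  moreover have "(if c = 0 then 0 else tail_count m (theta_legs a b (c - 1))) =
      (if c = 0 then 0 else tail_fun a b (c - 1))"
    using Suc by (cases c) (simp_all add: tail_fun_def)
  ultimately show ?thesis
    unfolding tail_fun_def[of a b c] gap_fun_def[of a b c] Suc tail_count.simps ex sum_lessThan_3
    by (simp only: One_nat_def theta_legs_simps theta_legs_upd add.assoc)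
qed

lemma theta_count_legs:
  "theta_count (theta_legs a b c) = 2 * tail_fun a b c +
     (if a = 0 then 0 else leg_sum (\<lambda>x. tail_fun x b c) (a - 1)) +
     (if b = 0 then 0 else leg_sum (\<lambda>x. tail_fun a x c) (b - 1)) +
     (if c = 0 then 0 else leg_sum (\<lambda>x. tail_fun a b x) (c - 1))"
proof -
  have "sum (theta_legs a b c) ({..<3} - {0}) = b + c"
    "sum (theta_legs a b c) ({..<3} - {1}) = a + c"
    "sum (theta_legs a b c) ({..<3} - {2}) = a + b"
    unfolding lessThan_3 by (simp_all add: insert_Diff_if)
  then have "tail_count (sum (theta_legs a b c) ({..<3} - {0}) + x) (theta_legs x b c) = tail_fun x b c"
    "tail_count (sum (theta_legs a b c) ({..<3} - {Suc 0}) + x) (theta_legs a x c) = tail_fun a x c"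
    "tail_count (sum (theta_legs a b c) ({..<3} - {2}) + x) (theta_legs a b x) = tail_fun a b x" for x
    unfolding tail_fun_def by (simp_all add: ac_simps)
  then show ?thesis
    unfolding theta_count_def sum_theta_legs sum_lessThan_3[of "\<lambda>k. if _ k then _ k else _ k"]
    by (simp only: theta_legs_simps theta_legs_upd One_nat_def tail_fun_def[of a b c] add.assoc)
qed

section \<open>Generating functions\<close>

definition gf3 :: "(nat \<Rightarrow> nat \<Rightarrow> nat \<Rightarrow> nat) \<Rightarrow> rat fps fps fps" where
  "gf3 f = Abs_fps (\<lambda>a. Abs_fps (\<lambda>b. Abs_fps (\<lambda>c. of_nat (f a b c))))"

lemma gf3_nth [simp]: "gf3 f $ a $ b $ c = of_nat (f a b c)"
  by (simp add: gf3_def)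

lemma nested_fps_eqI:
  fixes F G :: "'a::zero fps fps fps"
  assumes "\<And>a b c. F $ a $ b $ c = G $ a $ b $ c"
  shows "F = G"
  using assms by (intro fps_ext) auto

definition varx :: "'a::comm_ring_1 fps fps fps" where "varx = fps_X"
definition vary :: "'a::comm_ring_1 fps fps fps" where "vary = fps_const fps_X"
definition varz :: "'a::comm_ring_1 fps fps fps" where "varz = fps_const (fps_const fps_X)"

lemma var_mult_nth [simp]:
  "(varx * F) $ a $ b $ c = (if a = 0 then 0 else F $ (a - 1) $ b $ c)"
  "(vary * F) $ a $ b $ c = (if b = 0 then 0 else F $ a $ (b - 1) $ c)"
  "(varz * F) $ a $ b $ c = (if c = 0 then 0 else F $ a $ b $ (c - 1))"
  by (auto simp: varx_def vary_def varz_def)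

lemma var_nth [simp]:
  "varx $ a $ b $ c = (if a = 1 \<and> b = 0 \<and> c = 0 then 1 else 0)"
  "vary $ a $ b $ c = (if a = 0 \<and> b = 1 \<and> c = 0 then 1 else 0)"
  "varz $ a $ b $ c = (if a = 0 \<and> b = 0 \<and> c = 1 then 1 else 0)"
  by (auto simp: varx_def vary_def varz_def fps_X_def)

lemma one_nested_nth [simp]:
  "(1 :: 'a::comm_ring_1 fps fps fps) $ a $ b $ c = (if a = 0 \<and> b = 0 \<and> c = 0 then 1 else 0)"
  by simp

lemmas nested_nth = fps_add_nth var_mult_nth var_nth one_nested_nth gf3_nth

text \<open>The two-pole stage is entered only when some leg is exhausted, so \<open>gap_fun\<close>
  enters through its restrictions to coordinate planes and axes. They are kept as series in three
  variables so that all equations live in one ring.\<close>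

abbreviation "gap_yz \<equiv> gf3 (\<lambda>a b c. if a = 0 then gap_fun 0 b c else 0)"
abbreviation "gap_xz \<equiv> gf3 (\<lambda>a b c. if b = 0 then gap_fun a 0 c else 0)"
abbreviation "gap_xy \<equiv> gf3 (\<lambda>a b c. if c = 0 then gap_fun a b 0 else 0)"
abbreviation "gap_x \<equiv> gf3 (\<lambda>a b c. if b = 0 \<and> c = 0 then gap_fun a 0 0 else 0)"
abbreviation "gap_y \<equiv> gf3 (\<lambda>a b c. if a = 0 \<and> c = 0 then gap_fun 0 b 0 else 0)"
abbreviation "gap_z \<equiv> gf3 (\<lambda>a b c. if a = 0 \<and> b = 0 then gap_fun 0 0 c else 0)"
abbreviation "leg_x \<equiv> gf3 (\<lambda>a b c. leg_sum (\<lambda>m. tail_fun m b c) a)"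
abbreviation "leg_y \<equiv> gf3 (\<lambda>a b c. leg_sum (\<lambda>m. tail_fun a m c) b)"
abbreviation "leg_z \<equiv> gf3 (\<lambda>a b c. leg_sum (\<lambda>m. tail_fun a b m) c)"

text \<open>A coefficient 2 throughout would count the step from gap 1 to gap 0 twice; the extra
  variable on the left compensates, as \<open>ends 1 = 1\<close>.\<close>

lemma one_gap_gf_eqs:
  "gap_x + varx = 1 + varx * gap_x + varx * gap_x"
  "gap_y + vary = 1 + vary * gap_y + vary * gap_y"
  "gap_z + varz = 1 + varz * gap_z + varz * gap_z"
proof -
  have g: "gap_fun (Suc n) 0 0 = ends (Suc n) * gap_fun n 0 0"
    "gap_fun 0 (Suc n) 0 = ends (Suc n) * gap_fun 0 n 0"
    "gap_fun 0 0 (Suc n) = ends (Suc n) * gap_fun 0 0 n" for n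
    using gap_fun_rec[of "Suc n" 0 0] gap_fun_rec[of 0 "Suc n" 0] gap_fun_rec[of 0 0 "Suc n"]
    by (simp_all add: ends_def)
  show "gap_x + varx = 1 + varx * gap_x + varx * gap_x"
    by (rule nested_fps_eqI, unfold nested_nth, rename_tac a b c, case_tac a) (auto simp: g gap_fun_0 ends_def)
  show "gap_y + vary = 1 + vary * gap_y + vary * gap_y"
    by (rule nested_fps_eqI, unfold nested_nth, rename_tac a b c, case_tac b) (auto simp: g gap_fun_0 ends_def)
  show "gap_z + varz = 1 + varz * gap_z + varz * gap_z"
    by (rule nested_fps_eqI, unfold nested_nth, rename_tac a b c, case_tac c) (auto simp: g gap_fun_0 ends_def)
qed

text \<open>The same correction for two gaps: closing a gap of length 1 leaves only the other gap,
  hence \<open>vary * gap_z\<close> and \<open>varz * gap_y\<close>.\<close>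

lemma gap_yz_gf_eq: "gap_yz + vary * gap_z + varz * gap_y = 1 + vary * gap_yz + vary * gap_yz + varz * gap_yz + varz * gap_yz"
proof (rule nested_fps_eqI)
  fix a b c
  show "(gap_yz + vary * gap_z + varz * gap_y) $ a $ b $ c =
      (1 + vary * gap_yz + vary * gap_yz + varz * gap_yz + varz * gap_yz) $ a $ b $ c"
    unfolding nested_nth using gap_fun_rec[of 0 b c]
    by (cases "a = 0 \<and> b + c \<noteq> 0") (auto simp: gap_fun_0 ends_def)
qed

lemma gap_xz_gf_eq: "gap_xz + varx * gap_z + varz * gap_x = 1 + varx * gap_xz + varx * gap_xz + varz * gap_xz + varz * gap_xz"
proof (rule nested_fps_eqI)
  fix a b c
  show "(gap_xz + varx * gap_z + varz * gap_x) $ a $ b $ c =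
      (1 + varx * gap_xz + varx * gap_xz + varz * gap_xz + varz * gap_xz) $ a $ b $ c"
    unfolding nested_nth using gap_fun_rec[of a 0 c]
    by (cases "b = 0 \<and> a + c \<noteq> 0") (auto simp: gap_fun_0 ends_def)
qed

lemma gap_xy_gf_eq: "gap_xy + varx * gap_y + vary * gap_x = 1 + varx * gap_xy + varx * gap_xy + vary * gap_xy + vary * gap_xy"
proof (rule nested_fps_eqI)
  fix a b c
  show "(gap_xy + varx * gap_y + vary * gap_x) $ a $ b $ c =
      (1 + varx * gap_xy + varx * gap_xy + vary * gap_xy + vary * gap_xy) $ a $ b $ c"
    unfolding nested_nth using gap_fun_rec[of a b 0]
    by (cases "c = 0 \<and> a + b \<noteq> 0") (auto simp: gap_fun_0 ends_def)
qed

text \<open>Inclusion-exclusion over the condition that some length is 0: three planes, minus three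
  axes, plus the origin.\<close>

lemma tail_gf_eq:
  "gf3 tail_fun + gap_x + gap_y + gap_z = varx * gf3 tail_fun + vary * gf3 tail_fun + varz * gf3 tail_fun +
     gap_yz + gap_xz + gap_xy + 1"
proof (rule nested_fps_eqI)
  fix a b c
  show "(gf3 tail_fun + gap_x + gap_y + gap_z) $ a $ b $ c =
    (varx * gf3 tail_fun + vary * gf3 tail_fun + varz * gf3 tail_fun + gap_yz + gap_xz + gap_xy + 1) $ a $ b $ c"
    unfolding nested_nth using tail_fun_rec[of a b c]
    by (auto simp: gap_fun_0)
qed

lemma leg_gf_eqs:
  "leg_x = gf3 tail_fun + gf3 tail_fun + varx * leg_x + varx * leg_x"
  "leg_y = gf3 tail_fun + gf3 tail_fun + vary * leg_y + vary * leg_y"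
  "leg_z = gf3 tail_fun + gf3 tail_fun + varz * leg_z + varz * leg_z"
proof -
  show "leg_x = gf3 tail_fun + gf3 tail_fun + varx * leg_x + varx * leg_x"
    by (rule nested_fps_eqI, unfold nested_nth, rename_tac a b c, case_tac a) auto
  show "leg_y = gf3 tail_fun + gf3 tail_fun + vary * leg_y + vary * leg_y"
    by (rule nested_fps_eqI, unfold nested_nth, rename_tac a b c, case_tac b) auto
  show "leg_z = gf3 tail_fun + gf3 tail_fun + varz * leg_z + varz * leg_z"
    by (rule nested_fps_eqI, unfold nested_nth, rename_tac a b c, case_tac c) auto
qed

abbreviation "theta_gf \<equiv> gf3 (\<lambda>a b c. theta_count (theta_legs a b c))"

lemma theta_gf_eq: "theta_gf = gf3 tail_fun + gf3 tail_fun + varx * leg_x + vary * leg_y + varz * leg_z"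
  by (rule nested_fps_eqI, unfold nested_nth) (auto simp: theta_count_legs)

section \<open>Rational closed forms\<close>

text \<open>Numerator of the two-gap series over
  \<open>(1 - 2 * y) * (1 - 2 * z) * (1 - 2 * y - 2 * z)\<close>.\<close>

definition gap_num :: "'a::comm_ring_1 \<Rightarrow> 'a \<Rightarrow> 'a" where
  "gap_num y z = (1 - y - z) * (1 - 2 * y - 2 * z + 2 * y * z)"

text \<open>
  \<open>(low_num0 y z + x * low_num1 y z) / (u\<^sup>3 * v\<^sup>3 * t)\<close> is the part of degree below 2 in \<open>x\<close> of the
  generating function of \<open>theta_count\<close>; by symmetry \<open>low_num0 y x + z * low_num1 y x\<close> gives the part of
  degree below 2 in \<open>z\<close>.
\<close>

definition low_num0 :: "'a::comm_ring_1 \<Rightarrow> 'a \<Rightarrow> 'a" where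
  "low_num0 y z = (let u = 1 - 2 * y; v = 1 - 2 * z; t = 1 - 2 * y - 2 * z in
     u * v * (u * v + t) * (1 - y - z))"

definition low_num1 :: "'a::comm_ring_1 \<Rightarrow> 'a \<Rightarrow> 'a" where
  "low_num1 y z = (let u = 1 - 2 * y; v = 1 - 2 * z; t = 1 - 2 * y - 2 * z in
     (u^2 + v^2 + u * v) * t + u^2 * v^2 * (1 + u * v + t))"

text \<open>Over the common denominator, the four terms stand for the series of
  \<open>theta_count\<close>, its parts of low degree in x and in z, and their overlap. At y = 0 the
  coefficients of the overlap are 2, 6 and 20, the labeling numbers of an edge, a triangle, and two
  triangles sharing an edge.\<close>

lemma S_poly_identity:
  fixes x y z :: "'a::idom"
  assumes "X = 1 - 2 * x" "Y = 1 - 2 * y" "Z = 1 - 2 * z"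
    "XY = 1 - 2 * x - 2 * y" "XZ = 1 - 2 * x - 2 * z" "YZ = 1 - 2 * y - 2 * z" "S = 1 - x - y - z"
  shows "X * Y * Z * (Y * Z + X * Z + X * Y - X * Y * Z) *
      (X * XY * XZ * gap_num y z + Y * XY * YZ * gap_num x z + Z * XZ * YZ * gap_num x y
       - XY * XZ * YZ * ((1 - x) * Y * Z + (1 - y) * X * Z + (1 - z) * X * Y - X * Y * Z))
    - X^3 * XY * XZ * S * (low_num0 y z + x * low_num1 y z)
    - Z^3 * XZ * YZ * S * (low_num0 y x + z * low_num1 y x)
    + X^3 * Z^3 * XY * XZ * YZ * S *
      (Y * (Y + 1) + (3 * Y^2 + 2 * Y + 1) * (x + z) + (8 * Y^2 + 8 * Y + 4) * x * z)
    = 16 * x^2 * z^2 * S_poly x y z"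
  unfolding assms Let_def S_poly_def gap_num_def low_num0_def low_num1_def
  by algebra

lemma gap_gf_rational:
  fixes y z :: "'a::idom"
  assumes "E + y * Hz + z * Hy = 1 + y * E + y * E + z * E + z * E"
    "Hy + y = 1 + y * Hy + y * Hy" "Hz + z = 1 + z * Hz + z * Hz"
  shows "(1 - 2 * y) * (1 - 2 * z) * (1 - 2 * y - 2 * z) * E = gap_num y z"
proof -
  have Hy: "(1 - 2 * y) * Hy = 1 - y"
    using assms(2) by (simp add: algebra_simps)
  have Hz: "(1 - 2 * z) * Hz = 1 - z"
    using assms(3) by (simp add: algebra_simps)
  have E: "(1 - 2 * y - 2 * z) * E = 1 - y * Hz - z * Hy"
    using assms(1) by (simp add: algebra_simps)
  have "(1 - 2 * y) * (1 - 2 * z) * (1 - 2 * y - 2 * z) * E =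
      (1 - 2 * y) * (1 - 2 * z) - y * (1 - 2 * y) * ((1 - 2 * z) * Hz)
      - z * (1 - 2 * z) * ((1 - 2 * y) * Hy)"
    unfolding mult.assoc E by (simp add: algebra_simps)
  also have "\<dots> = gap_num y z"
    unfolding Hy Hz gap_num_def by (simp add: algebra_simps power2_eq_square)
  finally show ?thesis .
qed

lemma tail_gf_rational:
  fixes x y z :: "'a::idom"
  assumes "K + Hx + Hy + Hz = x * K + y * K + z * K + E1 + E2 + E3 + 1"
    and "X * Hx = 1 - x" "Y * Hy = 1 - y" "Z * Hz = 1 - z"
    and "Y * Z * YZ * E1 = nx" "X * Z * XZ * E2 = ny" "X * Y * XY * E3 = nz"
  shows "X * Y * Z * XY * XZ * YZ * (1 - x - y - z) * K =
    X * XY * XZ * nx + Y * XY * YZ * ny + Z * XZ * YZ * nz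
    - XY * XZ * YZ * ((1 - x) * Y * Z + (1 - y) * X * Z + (1 - z) * X * Y - X * Y * Z)"
proof -
  have "(1 - x - y - z) * K = E1 + E2 + E3 + 1 - Hx - Hy - Hz"
    using assms(1) by (simp add: algebra_simps)
  then have "X * Y * Z * XY * XZ * YZ * (1 - x - y - z) * K =
      X * Y * Z * XY * XZ * YZ * (E1 + E2 + E3 + 1 - Hx - Hy - Hz)"
    by (simp only: mult.assoc)
  also have "\<dots> = X * XY * XZ * (Y * Z * YZ * E1) + Y * XY * YZ * (X * Z * XZ * E2)
      + Z * XZ * YZ * (X * Y * XY * E3)
      - XY * XZ * YZ * ((X * Hx) * Y * Z + (Y * Hy) * X * Z + (Z * Hz) * X * Y - X * Y * Z)"
    by (simp add: algebra_simps)
  finally show ?thesis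
    by (simp only: assms)
qed

text \<open>Each of \<open>x * Mx\<close>, \<open>y * My\<close>, \<open>z * Mz\<close> contributes a term like \<open>2 * x / X * K = (1 / X - 1) * K\<close>.\<close>

lemma theta_gf_rational:
  fixes x y z :: "'a::idom"
  assumes "L = K + K + x * Mx + y * My + z * Mz"
    and "Mx = K + K + x * Mx + x * Mx" "My = K + K + y * My + y * My" "Mz = K + K + z * Mz + z * Mz"
    and "X = 1 - 2 * x" "Y = 1 - 2 * y" "Z = 1 - 2 * z"
  shows "X * Y * Z * L = (Y * Z + X * Z + X * Y - X * Y * Z) * K"
proof -
  have M: "X * Mx = 2 * K" "Y * My = 2 * K" "Z * Mz = 2 * K"
    unfolding assms(5-) using assms(2-4) by (simp_all add: algebra_simps)
  have "X * Y * Z * L = 2 * K * X * Y * Z + x * Y * Z * (X * Mx) + y * X * Z * (Y * My) + z * X * Y * (Z * Mz)"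
    unfolding assms(1) by (simp add: algebra_simps)
  also have "\<dots> = (Y * Z + X * Z + X * Y - X * Y * Z) * K"
    unfolding M unfolding assms(5-) by (simp add: algebra_simps)
  finally show ?thesis .
qed

section \<open>Degree below two in one variable\<close>

definition x_free :: "'a::comm_ring_1 fps fps fps \<Rightarrow> bool" where
  "x_free F \<longleftrightarrow> (\<exists>f. F = fps_const f)"

text \<open>Unlike x, the outermost variable, z is innermost, so independence of it is not constancy
  of the outer series and is expressed by coefficients.\<close>

definition z_free :: "'a::comm_ring_1 fps fps fps \<Rightarrow> bool" where
  "z_free F \<longleftrightarrow> (\<forall>a b c. 0 < c \<longrightarrow> F $ a $ b $ c = 0)"

lemma x_free_intros:
  "x_free 1" "x_free (numeral k)" "x_free vary" "x_free varz"
  "x_free F \<Longrightarrow> x_free G \<Longrightarrow> x_free (F + G)" "x_free F \<Longrightarrow> x_free G \<Longrightarrow> x_free (F - G)"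
  "x_free F \<Longrightarrow> x_free G \<Longrightarrow> x_free (F * G)" "x_free F \<Longrightarrow> x_free (F ^ n)"
  unfolding x_free_def vary_def varz_def
  by (metis fps_const_1_eq_1 numeral_fps_const fps_const_add fps_const_sub fps_const_mult fps_const_power)+

lemma z_free_mult:
  assumes "z_free F" "z_free G"
  shows "z_free (F * G)"
  unfolding z_free_def fps_mult_nth fps_sum_nth
proof (intro allI impI sum.neutral ballI)
  fix a b c i j k :: nat
  assume "0 < c" "k \<in> {0..c}"
  then have "0 < k \<or> 0 < c - k" by auto
  then show "F $ i $ j $ k * G $ (a - i) $ (b - j) $ (c - k) = 0"
    using assms by (auto simp: z_free_def)
qed

lemma z_free_1: "z_free 1"
  by (simp add: z_free_def)

lemma z_free_intros:
  "z_free 1" "z_free (numeral k)" "z_free varx" "z_free vary"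
  "z_free F \<Longrightarrow> z_free G \<Longrightarrow> z_free (F + G)" "z_free F \<Longrightarrow> z_free G \<Longrightarrow> z_free (F - G)"
  "z_free F \<Longrightarrow> z_free G \<Longrightarrow> z_free (F * G)" "z_free F \<Longrightarrow> z_free (F ^ n)"
proof -
  show "z_free F \<Longrightarrow> z_free (F ^ n)"
    by (induction n) (auto simp: z_free_1 z_free_mult)
  show "z_free (numeral k)"
    by (auto simp: z_free_def numeral_fps_const)
qed (auto simp: z_free_mult z_free_1, auto simp: z_free_def)

text \<open>Multiplication by an x-free \<open>D\<close> acts on each coefficient in x separately,
  so the quotient inherits the degree bound of the numerator.\<close>

lemma x_linear_quotient:
  fixes A D :: "'a::idom fps fps fps"
  assumes "A * D = P + varx * Q" "x_free D" "x_free P" "x_free Q" "D \<noteq> 0" "2 \<le> a"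
  shows "A $ a = 0"
proof -
  obtain d p q where "D = fps_const d" "P = fps_const p" "Q = fps_const q"
    using assms(2-4) by (auto simp: x_free_def)
  moreover from this have "(A * D) $ a = 0"
    using assms(1,6) by (simp add: varx_def)
  ultimately show ?thesis
    using assms(5) by auto
qed

lemma z_free_mult_nth:
  assumes "z_free D"
  shows "(D * F) $ a $ b $ c = (\<Sum>i=0..a. \<Sum>j=0..b. D $ i $ j $ 0 * F $ (a - i) $ (b - j) $ c)"
proof -
  have "D $ i $ j = fps_const (D $ i $ j $ 0)" for i j
    using assms by (intro fps_ext) (auto simp: z_free_def)
  then have "(D $ i $ j * G) $ c = D $ i $ j $ 0 * G $ c" for i j G
    by (metis fps_mult_left_const_nth)
  then show ?thesis
    by (simp add: fps_mult_nth fps_sum_nth)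
qed

lemma z_linear_quotient:
  fixes A D :: "'a::idom fps fps fps"
  assumes "A * D = P + varz * Q" "z_free D" "z_free P" "z_free Q" "D \<noteq> 0" "2 \<le> c"
  shows "A $ a $ b $ c = 0"
proof -
  \<comment> \<open>Discarding the terms of degree below 2 in \<open>z\<close> commutes with multiplication by \<open>D\<close>.\<close>
  define T where "T = Abs_fps (\<lambda>a. Abs_fps (\<lambda>b. Abs_fps (\<lambda>c. if 2 \<le> c then A $ a $ b $ c else 0)))"
  have "D * T = 0"
  proof (rule nested_fps_eqI)
    fix a b c
    show "(D * T) $ a $ b $ c = 0 $ a $ b $ c"
    proof (cases "2 \<le> c")
      case True
      then have "(D * T) $ a $ b $ c = (A * D) $ a $ b $ c"
        by (simp add: mult.commute[of A] z_free_mult_nth[OF assms(2)] T_def)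
      also have "\<dots> = 0"
        unfolding assms(1) using assms(3,4) True by (simp add: z_free_def)
      finally show ?thesis by simp
    qed (simp add: z_free_mult_nth[OF assms(2)] T_def)
  qed
  then have "T $ a $ b $ c = 0"
    using assms(5) by simp
  then show ?thesis
    using assms(6) by (simp add: T_def)
qed

lemma constant_term_simps:
  fixes F G :: "'a::comm_ring_1 fps fps fps"
  shows "(F * G) $ 0 $ 0 $ 0 = F $ 0 $ 0 $ 0 * G $ 0 $ 0 $ 0"
    and "(F ^ n) $ 0 $ 0 $ 0 = (F $ 0 $ 0 $ 0) ^ n"
  by (simp_all add: fps_mult_nth_0 fps_power_zeroth)

lemma nested_fps_eq_divideI:
  fixes F D N :: "'a::field fps fps fps"
  assumes "F * D = N" "D $ 0 $ 0 $ 0 \<noteq> 0"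
  shows "F = N / D"
proof -
  have "N / D * D = F * D"
    using nested_fps_divide_mult_cancel[OF assms(2)] assms(1) by simp
  moreover have "D \<noteq> 0"
    using assms(2) by auto
  ultimately show ?thesis
    by (metis mult_right_cancel)
qed

theorem theorem8:
  fixes x y z :: "rat fps fps fps"
  assumes "x = fps_X" and "y = fps_const fps_X" and "z = fps_const (fps_const fps_X)"
  shows "S_gf =
    (16 * x^2 * y^2 * z^2 * S_poly x y z) /
    ((1 - 2 * x)^3 * (1 - 2 * y)^3 * (1 - 2 * z)^3 *
     (1 - 2 * x - 2 * y) * (1 - 2 * x - 2 * z) * (1 - 2 * y - 2 * z) * (1 - x - y - z))"
proof -
  have var: "x = varx" "y = vary" "z = varz"
    by (simp_all add: assms varx_def vary_def varz_def)
  have const: "x $ 0 $ 0 $ 0 = 0" "y $ 0 $ 0 $ 0 = 0" "z $ 0 $ 0 $ 0 = 0"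
    by (simp_all add: var)
  define X Y Z XY XZ YZ S where defs: "X = 1 - 2 * x" "Y = 1 - 2 * y" "Z = 1 - 2 * z"
    "XY = 1 - 2 * x - 2 * y" "XZ = 1 - 2 * x - 2 * z" "YZ = 1 - 2 * y - 2 * z" "S = 1 - x - y - z"
  have units: "X $ 0 $ 0 $ 0 = 1" "Y $ 0 $ 0 $ 0 = 1" "Z $ 0 $ 0 $ 0 = 1" "XY $ 0 $ 0 $ 0 = 1"
    "XZ $ 0 $ 0 $ 0 = 1" "YZ $ 0 $ 0 $ 0 = 1" "S $ 0 $ 0 $ 0 = 1"
    unfolding defs by (simp_all add: const constant_term_simps)
  define D where "D = X^3 * Y^3 * Z^3 * XY * XZ * YZ * S"
  have D0: "D $ 0 $ 0 $ 0 = 1"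
    unfolding D_def constant_term_simps units by simp
  let ?K = "gf3 tail_fun" and ?L = theta_gf

  note M = leg_gf_eqs[folded var] and H = one_gap_gf_eqs[folded var]
  have L: "X * Y * Z * ?L = (Y * Z + X * Z + X * Y - X * Y * Z) * ?K"
    by (rule theta_gf_rational[OF theta_gf_eq[folded var] M defs(1-3)])
  have "X * gap_x = 1 - x" "Y * gap_y = 1 - y" "Z * gap_z = 1 - z"
    unfolding defs using H by (simp_all add: algebra_simps)
  moreover have "Y * Z * YZ * gap_yz = gap_num y z" "X * Z * XZ * gap_xz = gap_num x z"
    "X * Y * XY * gap_xy = gap_num x y"
    unfolding defs using gap_gf_rational[OF gap_yz_gf_eq[folded var] H(2,3)]
      gap_gf_rational[OF gap_xz_gf_eq[folded var] H(1,3)] gap_gf_rational[OF gap_xy_gf_eq[folded var] H(1,2)]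
    by simp_all
  ultimately have K: "X * Y * Z * XY * XZ * YZ * S * ?K =
      X * XY * XZ * gap_num y z + Y * XY * YZ * gap_num x z + Z * XZ * YZ * gap_num x y
      - XY * XZ * YZ * ((1 - x) * Y * Z + (1 - y) * X * Z + (1 - z) * X * Y - X * Y * Z)"
      (is "_ = ?N")
    unfolding defs(7) by (rule tail_gf_rational[OF tail_gf_eq[folded var]])
  \<comment> \<open>One factor \<open>X * Y * Z\<close> clears the sum over starting vertices, a
    second belongs to the tail series, and a third is left over.\<close>
  have "D * ?L = X * X * Y * Y * Z * Z * XY * XZ * YZ * S * (X * Y * Z * ?L)"
    unfolding D_def by (simp add: power3_eq_cube ac_simps)
  also have "\<dots> = X * Y * Z * (Y * Z + X * Z + X * Y - X * Y * Z) * (X * Y * Z * XY * XZ * YZ * S * ?K)"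
    unfolding L by (simp only: ac_simps)
  finally have DL: "D * ?L = X * Y * Z * (Y * Z + X * Z + X * Y - X * Y * Z) * ?N"
    unfolding K .

  \<comment> \<open>The parts of low degree in \<open>x\<close> (\<open>A\<close>), in \<open>z\<close> (\<open>B\<close>), and in both (\<open>C\<close>).\<close>
  define A where "A = (low_num0 y z + x * low_num1 y z) / (Y^3 * Z^3 * YZ)"
  define B where "B = (low_num0 y x + z * low_num1 y x) / (X^3 * Y^3 * XY)"
  define C where "C = ((Y * (Y + 1) + (3 * Y^2 + 2 * Y + 1) * z) +
    x * (3 * Y^2 + 2 * Y + 1 + (8 * Y^2 + 8 * Y + 4) * z)) / Y^3"
  have A: "A * (Y^3 * Z^3 * YZ) = low_num0 y z + x * low_num1 y z"
    unfolding A_def by (rule nested_fps_divide_mult_cancel) (simp add: constant_term_simps units)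
  have B: "B * (X^3 * Y^3 * XY) = low_num0 y x + z * low_num1 y x"
    unfolding B_def by (rule nested_fps_divide_mult_cancel) (simp add: constant_term_simps units)
  have C: "C * Y^3 = (Y * (Y + 1) + (3 * Y^2 + 2 * Y + 1) * z) +
    x * (3 * Y^2 + 2 * Y + 1 + (8 * Y^2 + 8 * Y + 4) * z)"
    unfolding C_def by (rule nested_fps_divide_mult_cancel) (simp add: constant_term_simps units)
  have A_nth: "A $ a = 0" if "2 \<le> a" for a
  proof (rule x_linear_quotient[OF A[unfolded var(1)] _ _ _ _ that])
    show "Y^3 * Z^3 * YZ \<noteq> 0"
      using units by auto
  qed (unfold defs low_num0_def low_num1_def Let_def var, (intro x_free_intros)+)
  have B_nth: "B $ a $ b $ c = 0" if "2 \<le> c" for a b c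
  proof (rule z_linear_quotient[OF B[unfolded var(3)] _ _ _ _ that])
    show "X^3 * Y^3 * XY \<noteq> 0"
      using units by auto
  qed (unfold defs low_num0_def low_num1_def Let_def var, (intro z_free_intros)+)
  have C_nth: "C $ a = 0" if "2 \<le> a" for a
  proof (rule x_linear_quotient[OF C[unfolded var(1)] _ _ _ _ that])
    show "Y^3 \<noteq> 0"
      using units by auto
  qed (unfold defs var, (intro x_free_intros)+)

  define R where "R = ?L - A - B + C"
  have "R * D = D * ?L - X^3 * XY * XZ * S * (A * (Y^3 * Z^3 * YZ))
      - Z^3 * XZ * YZ * S * (B * (X^3 * Y^3 * XY)) + X^3 * Z^3 * XY * XZ * YZ * S * (C * Y^3)"
    unfolding R_def D_def by (simp add: algebra_simps)
  also have "\<dots> = 16 * x^2 * z^2 * S_poly x y z"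
    unfolding A B C DL S_poly_identity[OF defs, symmetric] by (simp add: algebra_simps)
  finally have R: "R * D = 16 * x^2 * z^2 * S_poly x y z" .
  \<comment> \<open>\<open>D\<close> has constant term 1, so \<open>Q\<close> is a true quotient and
    \<open>R\<close> is divisible by x^2 z^2 as a power series.\<close>
  define Q where "Q = 16 * S_poly x y z / D"
  have "Q * D = 16 * S_poly x y z"
    unfolding Q_def using D0 by (intro nested_fps_divide_mult_cancel) simp
  then have "R * D = x * (x * (z * (z * Q))) * D"
    unfolding R by (simp add: power2_eq_square ac_simps)
  moreover have "D \<noteq> 0"
    using D0 by auto
  ultimately have RQ: "R = x * (x * (z * (z * Q)))"
    by simp

  \<comment> \<open>If both outer exponents are at least 2, the corrections vanish and
    \<open>R\<close> agrees with \<open>theta_gf\<close>; otherwise divisibility makes its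
    coefficient 0. The two factors \<open>y\<close> account for the poles at the ends of the middle
    path.\<close>
  have "S_gf = y * (y * R)"
  proof (rule nested_fps_eqI)
    fix a b c
    show "S_gf $ a $ b $ c = (y * (y * R)) $ a $ b $ c"
    proof (cases "2 \<le> a \<and> 2 \<le> b \<and> 2 \<le> c")
      case True
      then have "(y * (y * R)) $ a $ b $ c = ?L $ a $ (b - 2) $ c"
        by (simp add: var R_def A_nth B_nth C_nth numeral_2_eq_2)
      also have "\<dots> = S_gf $ a $ b $ c"
        using True num_labelings_S_graph[of a c "b - 2"]
        by (simp add: S_gf_def del: add_2_eq_Suc')
      finally show ?thesis by simp
    next
      case False
      then show ?thesis
        unfolding RQ by (auto simp: var S_gf_def)
    qed
  qed
  then have "S_gf * D = y^2 * (R * D)"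
    by (simp add: power2_eq_square ac_simps)
  also have "\<dots> = 16 * x^2 * y^2 * z^2 * S_poly x y z"
    unfolding R by (simp only: ac_simps)
  finally have "S_gf = (16 * x^2 * y^2 * z^2 * S_poly x y z) / D"
    using D0 by (intro nested_fps_eq_divideI) simp_all
  then show ?thesis
    unfolding D_def defs .
qed

end
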